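(* A set $X\subset\mathbb{R}^d$ is complementary regular if and only if there exist a compact set $Y\subset\mathbb{R}^d$ and a real $\varepsilon>0$ which is a regular value of $d_Y$ such that $X=Y^{\varepsilon}=\{x: d_Y(x)\le\varepsilon\}$.
   Context: $d_A(x)=\inf_{a\in A}\|x-a\|$. For a locally Lipschitz $\phi$, the Clarke gradient $\partial\phi(x)$ is the convex hull of all limits $\lim_i\nabla\phi(x_i)$ with $x_i\to x$ and $\phi$ differentiable at $x_i$; $\varepsilon$ is a regular value of $\phi$ if $0\notin\partial\phi(x)$ for all $x\in\phi^{-1}(\varepsilon)$. $\Delta(B)=\inf_{b\in B}\|b\|$. Complement set $\mathcal{C}A:=\overline{\mathbb{R}^d\setminus A}$. Reach of closed $A$: supremum of $t\ge0$ such that every $x$ with $d_A(x)<t$ has a unique nearest point in $A$. For $\mu\in(0,1]$, $\operatorname{reach}_\mu(A)=\sup\{s:\Delta(\partial d_A(x))\ge\mu\text{ for all }x\text{ with }0<d_A(x)\le s\}$. A compact $X$ is complementary regular if (i) $\overline{\operatorname{int}X}=X$, (ii) $\operatorname{reach}_\mu(X)>0$ for some $\mu\in(0,1]$, (iii) $\operatorname{reach}(\mathcal{C}X)>0$. *)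

theory Defs
  imports "HOL-Analysis.Analysis"
begin

definition dist_fun :: "'a::euclidean_space set \<Rightarrow> 'a \<Rightarrow> real" where
  "dist_fun A x = infdist x A"

definition clarke_grad :: "('a::euclidean_space \<Rightarrow> real) \<Rightarrow> 'a \<Rightarrow> 'a set" where
  "clarke_grad \<phi> x = convex hull
     {g. \<exists>(s::nat \<Rightarrow> 'a) (G::nat \<Rightarrow> 'a). s \<longlonglongrightarrow> x \<and> G \<longlonglongrightarrow> g \<and>
          (\<forall>i. (\<phi> has_derivative (\<lambda>h. G i \<bullet> h)) (at (s i)))}"

definition regular_value :: "('a::euclidean_space \<Rightarrow> real) \<Rightarrow> real \<Rightarrow> bool" where
  "regular_value \<phi> \<epsilon> \<longleftrightarrow> (\<forall>x. \<phi> x = \<epsilon> \<longrightarrow> 0 \<notin> clarke_grad \<phi> x)"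

definition Delta :: "'a::real_normed_vector set \<Rightarrow> real" where
  "Delta B = Inf (norm ` B)"

definition compl_set :: "'a::euclidean_space set \<Rightarrow> 'a set" where
  "compl_set A = closure (UNIV - A)"

definition reach :: "'a::euclidean_space set \<Rightarrow> ereal" where
  "reach A = Sup (ereal ` {t. t \<ge> 0 \<and>
      (\<forall>x. dist_fun A x < t \<longrightarrow> (\<exists>!a. a \<in> A \<and> dist x a = dist_fun A x))})"

definition reach_mu :: "real \<Rightarrow> 'a::euclidean_space set \<Rightarrow> ereal" where
  "reach_mu \<mu> A = Sup (ereal ` {s. \<forall>x. 0 < dist_fun A x \<and> dist_fun A x \<le> s \<longrightarrow>
      Delta (clarke_grad (dist_fun A) x) \<ge> \<mu>})"

definition complementary_regular :: "'a::euclidean_space set \<Rightarrow> bool" where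
  "complementary_regular X \<longleftrightarrow> compact X \<and>
     closure (interior X) = X \<and>
     (\<exists>\<mu>. 0 < \<mu> \<and> \<mu> \<le> 1 \<and> reach_mu \<mu> X > 0) \<and>
     reach (compl_set X) > 0"

text \<open>Offset Y^eps = {x. d_Y(x) <= eps}; with the paper's convention d_{empty} = +infinity
  this is empty when Y is empty (Isabelle's infdist x {} = 0 would give UNIV instead).\<close>
definition offset :: "'a::euclidean_space set \<Rightarrow> real \<Rightarrow> 'a set" where
  "offset Y \<epsilon> = (if Y = {} then {} else {x. dist_fun Y x \<le> \<epsilon>})"

end

theory Submission
  imports Defs
begin

text \<open>Off a closed set \<open>A\<close>, the Clarke gradient of the distance function \<open>d\<close> of \<open>A\<close> is the convex hull of
  the unit vectors pointing from the nearest points of \<open>x\<close> to \<open>x\<close>. If it misses \<open>0\<close>, separation gives a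
  direction in which \<open>d\<close> grows at a definite rate, uniformly near \<open>x\<close>.

  Offsets at regular values: the distance function of \<open>X = Y\<^sup>\<epsilon>\<close> is that of \<open>Y\<close> minus \<open>\<epsilon>\<close> outside \<open>X\<close>, so
  compactness of the level set bounds its gradients below near \<open>X\<close>. The complement set is
  \<open>Z = {d\<^sub>Y \<ge> \<epsilon>}\<close>. If \<open>x\<close>, at distance \<open>r\<close> from \<open>Z\<close>, has two nearest points in \<open>Z\<close> at distance \<open>L\<close> from
  each other, their midpoint \<open>m\<close> is at distance at least \<open>L\<^sup>2 / 8r\<close> from \<open>Z\<close>; semiconcavity of the squared
  distance gives \<open>d\<^sub>Y(m)\<^sup>2 \<ge> \<epsilon>\<^sup>2 - L\<^sup>2 / 4\<close>, and moving from \<open>m\<close> in the growth direction reaches \<open>Z\<close> within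
  a distance of order \<open>L\<^sup>2\<close>. This bounds \<open>r\<close> from below.

  Conversely, let \<open>Z\<close> be the complement set of \<open>X\<close>, let \<open>\<epsilon>\<close> be less than its reach and let
  \<open>Y = {d\<^sub>Z \<ge> \<epsilon>}\<close>. Normals of \<open>Z\<close> can be extended up to the reach, whence \<open>X = Y\<^sup>\<epsilon>\<close>. If \<open>x\<close> were critical
  with \<open>d\<^sub>Y(x) = \<epsilon>\<close>, then every \<open>q\<close> would have a nearest point \<open>a\<close> of \<open>x\<close> in \<open>Y\<close> with
  \<open>\<bar>q - a\<bar>\<^sup>2 \<le> \<epsilon>\<^sup>2 + \<bar>q - x\<bar>\<^sup>2\<close>, making \<open>d\<^sub>X(q)\<close> quadratically small in \<open>\<bar>q - x\<bar>\<close>; but the gradient bound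
  provides \<open>q\<close> arbitrarily near \<open>x\<close> where \<open>d\<^sub>X(q)\<close> is at least a fixed multiple of \<open>\<bar>q - x\<bar>\<close>.\<close>

lemma LIMSEQ_0_if_less_inverse_Suc:
  fixes f :: "nat \<Rightarrow> real"
  assumes "\<And>n. 0 \<le> f n" "\<And>n. f n < inverse (real (Suc n))"
  shows "f \<longlonglongrightarrow> 0"
proof (rule tendsto_sandwich[OF _ _ tendsto_const LIMSEQ_inverse_real_of_nat])
  show "\<forall>\<^sub>F n in sequentially. 0 \<le> f n"
    by (rule always_eventually) (use assms(1) in blast)
  show "\<forall>\<^sub>F n in sequentially. f n \<le> inverse (real (Suc n))"
    by (rule always_eventually) (use assms(2) less_imp_le in blast)
qed

subsection \<open>The Clarke gradient of a distance function\<close>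

definition nearest :: "'a::euclidean_space set \<Rightarrow> 'a \<Rightarrow> 'a set" where
  "nearest A x = {a \<in> A. dist x a = infdist x A}"

lemma nearest_nonempty: "closed A \<Longrightarrow> A \<noteq> {} \<Longrightarrow> nearest A x \<noteq> {}"
  using infdist_attains_inf[of A x] unfolding nearest_def by (metis (mono_tags) empty_iff mem_Collect_eq)

lemma nearest_selection:
  assumes "closed A" "A \<noteq> {}"
  shows "\<exists>b. \<forall>n. b n \<in> nearest A (s n)"
  using nearest_nonempty[OF assms] by (intro choice) blast

lemma compact_nearest:
  assumes "closed A"
  shows "compact (nearest A x)"
proof -
  have "nearest A x = A \<inter> sphere x (infdist x A)"
    by (auto simp: nearest_def)
  then show ?thesis
    by (simp add: assms closed_Int_compact)
qed

text \<open>The distance is continuous, so nearest points of a convergent sequence stay bounded, and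
  every subsequential limit realises the distance at the limit point.\<close>

lemma nearest_subseq:
  fixes A :: "'a::euclidean_space set"
  assumes "closed A" "s \<longlonglongrightarrow> x" and near: "\<And>n. b n \<in> nearest A (s n)"
  obtains a r where "a \<in> nearest A x" "strict_mono (r :: nat \<Rightarrow> nat)" "(b \<circ> r) \<longlonglongrightarrow> a"
proof -
  have lim_dist: "(\<lambda>n. infdist (s n) A) \<longlonglongrightarrow> infdist x A"
    using assms(2) by (rule tendsto_infdist)
  have "Bseq (\<lambda>n. norm (s n) + infdist (s n) A)"
    using tendsto_add[OF tendsto_norm[OF assms(2)] lim_dist] convergentI convergent_imp_Bseq by blast
  then obtain K where K: "\<And>n. norm (norm (s n) + infdist (s n) A) \<le> K"
    by (auto simp: Bseq_def)
  have "norm (b n) \<le> K" for n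
  proof -
    have "norm (b n) \<le> norm (s n) + dist (s n) (b n)"
      unfolding dist_norm using norm_triangle_ineq2[of "b n" "s n"] by (simp add: norm_minus_commute)
    then show ?thesis
      using K[of n] near[of n] by (auto simp: nearest_def)
  qed
  then have "bounded (range b)"
    by (auto simp: bounded_iff)
  then obtain a r where r: "strict_mono (r :: nat \<Rightarrow> nat)" and lim: "(b \<circ> r) \<longlonglongrightarrow> a"
    using bounded_imp_convergent_subsequence by blast
  have "(\<lambda>n. dist ((s \<circ> r) n) ((b \<circ> r) n)) \<longlonglongrightarrow> dist x a"
    by (intro tendsto_dist lim LIMSEQ_subseq_LIMSEQ[OF assms(2) r])
  moreover have "(\<lambda>n. dist ((s \<circ> r) n) ((b \<circ> r) n)) \<longlonglongrightarrow> infdist x A"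
    using LIMSEQ_subseq_LIMSEQ[OF lim_dist r] near by (simp add: nearest_def o_def)
  ultimately have "dist x a = infdist x A"
    using LIMSEQ_unique by blast
  moreover have "a \<in> A"
    using closed_sequentially[OF assms(1) _ lim] near by (simp add: nearest_def)
  ultimately show thesis
    using that r lim by (auto simp: nearest_def)
qed

text \<open>The foot \<open>a\<close> bounds the distance from above; the 1-Lipschitz property,
  applied from \<open>x\<close>, bounds it from below.\<close>

lemma nearest_dist_segment:
  assumes "a \<in> nearest A x" "0 \<le> t" "t \<le> 1"
  shows "infdist (a + t *\<^sub>R (x - a)) A = t * norm (x - a)"
proof (rule antisym)
  have "dist (a + t *\<^sub>R (x - a)) a = t * norm (x - a)"
    using assms by (simp add: dist_norm)
  then show "infdist (a + t *\<^sub>R (x - a)) A \<le> t * norm (x - a)"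
    using assms(1) infdist_le by (metis (mono_tags, lifting) mem_Collect_eq nearest_def)
  have "x - (a + t *\<^sub>R (x - a)) = (1 - t) *\<^sub>R (x - a)"
    by (simp add: algebra_simps)
  then have "dist x (a + t *\<^sub>R (x - a)) = (1 - t) * norm (x - a)"
    using assms by (simp add: dist_norm)
  moreover have "norm (x - a) = infdist x A"
    using assms by (simp add: nearest_def dist_norm)
  ultimately show "t * norm (x - a) \<le> infdist (a + t *\<^sub>R (x - a)) A"
    using infdist_triangle[of x A "a + t *\<^sub>R (x - a)"] by (simp add: algebra_simps)
qed

section \<open>Differentiability of the distance function and the formula for its Clarke
  gradient\<close>

lemma has_derivative_squeeze:
  fixes f l u :: "'a::real_normed_vector \<Rightarrow> real"
  assumes "(l has_derivative D) (at x)" "(u has_derivative D) (at x)"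
    and "l x = f x" "u x = f x" "\<And>y. l y \<le> f y" "\<And>y. f y \<le> u y"
  shows "(f has_derivative D) (at x)"
  unfolding has_derivative_at_alt
proof (intro conjI allI impI)
  show "bounded_linear D"
    using assms(1) by (rule has_derivative_bounded_linear)
  fix e :: real
  assume "e > 0"
  obtain d1 where d1: "d1 > 0" "\<And>y. norm (y - x) < d1 \<Longrightarrow> norm (l y - l x - D (y - x)) \<le> e * norm (y - x)"
    using assms(1) \<open>e > 0\<close> unfolding has_derivative_at_alt by blast
  obtain d2 where d2: "d2 > 0" "\<And>y. norm (y - x) < d2 \<Longrightarrow> norm (u y - u x - D (y - x)) \<le> e * norm (y - x)"
    using assms(2) \<open>e > 0\<close> unfolding has_derivative_at_alt by blast
  have "norm (f y - f x - D (y - x)) \<le> e * norm (y - x)" if "norm (y - x) < min d1 d2" for y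
    using d1(2)[of y] d2(2)[of y] that assms(3-4) assms(5,6)[of y] by (auto simp: abs_le_iff)
  then show "\<exists>d>0. \<forall>y. norm (y - x) < d \<longrightarrow> norm (f y - f x - D (y - x)) \<le> e * norm (y - x)"
    using d1(1) d2(1) by (intro exI[of _ "min d1 d2"]) auto
qed

lemma has_derivative_dist_const:
  fixes y c :: "'a::real_inner"
  assumes "y \<noteq> c"
  shows "((\<lambda>z. norm (z - c)) has_derivative (\<lambda>h. sgn (y - c) \<bullet> h)) (at y)"
proof -
  have "((\<lambda>z. z - c) has_derivative (\<lambda>h. h)) (at y)"
    by (auto intro!: derivative_eq_intros)
  moreover have "(norm has_derivative (\<lambda>h. h \<bullet> sgn (y - c))) (at (y - c))"
    using assms by (intro has_derivative_norm) auto
  ultimately show ?thesis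
    using has_derivative_compose[of "\<lambda>z. z - c" "\<lambda>h. h" y UNIV norm "\<lambda>h. h \<bullet> sgn (y - c)"]
    by (simp add: inner_commute)
qed

lemma sgn_scaleR_pos: "0 < t \<Longrightarrow> sgn (t *\<^sub>R x) = sgn (x :: 'a::real_normed_vector)"
  by (simp add: sgn_scaleR)

text \<open>The functions \<open>norm (z - a)\<close> and \<open>infdist x A - norm (z - x)\<close>
  enclose the distance function and touch it, with equal gradients, at points strictly between
  \<open>a\<close> and \<open>x\<close>; strictness keeps both norms away from their kinks.\<close>

lemma infdist_differentiable_segment:
  assumes a: "a \<in> nearest A x" and "x \<notin> A" "0 < t" "t < 1"
  shows "((\<lambda>z. infdist z A) has_derivative (\<lambda>h. sgn (x - a) \<bullet> h)) (at (a + t *\<^sub>R (x - a)))"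
proof -
  define y where "y = a + t *\<^sub>R (x - a)"
  have "a \<in> A" "norm (x - a) = infdist x A"
    using a by (auto simp: nearest_def dist_norm)
  then have "x \<noteq> a"
    using assms(2) by auto
  have ya: "y - a = t *\<^sub>R (x - a)" and yx: "x - y = (1 - t) *\<^sub>R (x - a)"
    by (simp_all add: y_def algebra_simps)
  have ne: "y \<noteq> a" "y \<noteq> x"
    using ya yx \<open>x \<noteq> a\<close> assms(3,4) by auto
  have dy: "infdist y A = t * norm (x - a)"
    unfolding y_def using nearest_dist_segment[OF a] assms(3,4) by simp
  have "((\<lambda>z. norm (z - a)) has_derivative (\<lambda>h. sgn (x - a) \<bullet> h)) (at y)"
    using has_derivative_dist_const[OF ne(1)] assms(3) by (simp add: ya sgn_scaleR_pos)
  moreover have "((\<lambda>z. infdist x A - norm (z - x)) has_derivative (\<lambda>h. sgn (x - a) \<bullet> h)) (at y)"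
  proof -
    have "sgn (y - x) = - sgn (x - a)"
      using yx assms(4) by (metis minus_diff_eq sgn_minus sgn_scaleR_pos diff_gt_0_iff_gt)
    then show ?thesis
      using has_derivative_diff[OF has_derivative_const has_derivative_dist_const[OF ne(2)]] by simp
  qed
  moreover have "norm (y - a) = infdist y A" "infdist x A - norm (y - x) = infdist y A"
    unfolding norm_minus_commute[of y x] ya yx dy using assms(3,4) \<open>norm (x - a) = infdist x A\<close>
    by (simp_all add: left_diff_distrib)
  moreover have "infdist z A \<le> norm (z - a)" for z
    using infdist_le[OF \<open>a \<in> A\<close>, of z] by (simp add: dist_norm)
  moreover have "infdist x A - norm (z - x) \<le> infdist z A" for z
    using infdist_triangle[of x A z] by (simp add: dist_norm norm_minus_commute)
  ultimately show ?thesis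
    unfolding y_def[symmetric]
    using has_derivative_squeeze[of "\<lambda>z. infdist x A - norm (z - x)" "\<lambda>h. sgn (x - a) \<bullet> h" y
        "\<lambda>z. norm (z - a)" "\<lambda>z. infdist z A"] by blast
qed

text \<open>The function \<open>norm (z - a) - infdist z A\<close> is nonnegative and vanishes at
  \<open>s\<close>, so its derivative there is zero.\<close>

lemma gradient_infdist_eq:
  assumes deriv: "((\<lambda>z. infdist z A) has_derivative (\<lambda>h. g \<bullet> h)) (at s)"
    and a: "a \<in> nearest A s" and "s \<notin> A"
  shows "g = sgn (s - a)"
proof -
  have "a \<in> A" "norm (s - a) = infdist s A" "s \<noteq> a"
    using a assms(3) by (auto simp: nearest_def dist_norm)
  have "((\<lambda>z. norm (z - a) - infdist z A) has_derivative (\<lambda>h. sgn (s - a) \<bullet> h - g \<bullet> h)) (at s)"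
    by (intro has_derivative_diff has_derivative_dist_const deriv \<open>s \<noteq> a\<close>)
  moreover have "\<forall>z\<in>UNIV. norm (s - a) - infdist s A \<le> norm (z - a) - infdist z A"
    using infdist_le[OF \<open>a \<in> A\<close>] \<open>norm (s - a) = infdist s A\<close> by (simp add: dist_norm)
  ultimately have "(\<lambda>h. sgn (s - a) \<bullet> h - g \<bullet> h) = (\<lambda>h. 0)"
    using differential_zero_maxmin[of s UNIV "\<lambda>z. norm (z - a) - infdist z A"] by auto
  then have "(sgn (s - a) - g) \<bullet> (sgn (s - a) - g) = 0"
    by (metis inner_diff_left)
  then show ?thesis
    by simp
qed

text \<open>Gradients off \<open>A\<close> are unit vectors from nearest points, and these converge
  along a subsequence by \<open>nearest_subseq\<close>. Conversely, \<open>sgn (x - a)\<close> is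
  the constant gradient along the open segment from \<open>a\<close> to \<open>x\<close>, hence a
  limit of gradients.\<close>

lemma clarke_grad_dist_fun:
  fixes A :: "'a::euclidean_space set"
  assumes "closed A" "A \<noteq> {}" "x \<notin> A"
  shows "clarke_grad (dist_fun A) x = convex hull ((\<lambda>a. sgn (x - a)) ` nearest A x)"
proof -
  have d_eq: "dist_fun A = (\<lambda>z. infdist z A)"
    by (simp add: dist_fun_def fun_eq_iff)
  have "{g. \<exists>(s::nat \<Rightarrow> 'a) (G::nat \<Rightarrow> 'a). s \<longlonglongrightarrow> x \<and> G \<longlonglongrightarrow> g \<and>
          (\<forall>i. (dist_fun A has_derivative (\<lambda>h. G i \<bullet> h)) (at (s i)))}
        = (\<lambda>a. sgn (x - a)) ` nearest A x" (is "?L = ?R")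
  proof (intro equalityI subsetI)
    fix g
    assume "g \<in> ?L"
    then obtain s G where s: "s \<longlonglongrightarrow> x" and G: "G \<longlonglongrightarrow> g"
      and deriv: "\<And>i. ((\<lambda>z. infdist z A) has_derivative (\<lambda>h. G i \<bullet> h)) (at (s i))"
      unfolding d_eq by blast
    \<comment> \<open>Gradients are identified only off the closed set \<open>A\<close>, so an
      initial segment of the sequence is dropped.\<close>
    have "eventually (\<lambda>n. s n \<in> - A) sequentially"
      using s assms(1,3) by (intro topological_tendstoD) auto
    then obtain N where N: "\<And>n. n \<ge> N \<Longrightarrow> s n \<notin> A"
      by (auto simp: eventually_sequentially)
    obtain b where b: "\<And>n. b n \<in> nearest A (s (n + N))"
      using nearest_selection[OF assms(1,2), of "\<lambda>n. s (n + N)"] by blast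
    have sN: "(\<lambda>n. s (n + N)) \<longlonglongrightarrow> x" and GN: "(\<lambda>n. G (n + N)) \<longlonglongrightarrow> g"
      using s G by (auto intro: LIMSEQ_ignore_initial_segment)
    obtain a r where a: "a \<in> nearest A x" and r: "strict_mono (r :: nat \<Rightarrow> nat)" and lim: "(b \<circ> r) \<longlonglongrightarrow> a"
      using nearest_subseq[OF assms(1) sN b] by metis
    have "x \<noteq> a"
      using a assms(3) by (auto simp: nearest_def)
    then have "(\<lambda>n. sgn (((\<lambda>n. s (n + N)) \<circ> r) n - (b \<circ> r) n)) \<longlonglongrightarrow> sgn (x - a)"
      by (intro tendsto_sgn tendsto_diff lim LIMSEQ_subseq_LIMSEQ[OF sN r]) auto
    moreover have "(\<lambda>n. sgn (((\<lambda>n. s (n + N)) \<circ> r) n - (b \<circ> r) n)) = (\<lambda>n. G (n + N)) \<circ> r"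
      using gradient_infdist_eq[OF deriv b N] by (simp add: fun_eq_iff)
    ultimately have "((\<lambda>n. G (n + N)) \<circ> r) \<longlonglongrightarrow> sgn (x - a)"
      by (simp only:)
    then have "g = sgn (x - a)"
      using LIMSEQ_subseq_LIMSEQ[OF GN r] LIMSEQ_unique by blast
    then show "g \<in> ?R"
      using a by blast
  next
    fix g
    assume "g \<in> ?R"
    then obtain a where a: "a \<in> nearest A x" and g: "g = sgn (x - a)"
      by blast
    \<comment> \<open>The double \<open>Suc\<close> keeps \<open>t n\<close> strictly above 0, as
      differentiability on the segment requires.\<close>
    define t where "t n = 1 - inverse (real (Suc (Suc n)))" for n
    have t: "0 < t n" "t n < 1" for n
      by (auto simp: t_def field_simps)
    have "t \<longlonglongrightarrow> 1 - 0"
      unfolding t_def using LIMSEQ_Suc[OF LIMSEQ_inverse_real_of_nat] by (intro tendsto_diff) auto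
    then have "(\<lambda>n. a + t n *\<^sub>R (x - a)) \<longlonglongrightarrow> a + 1 *\<^sub>R (x - a)"
      by (intro tendsto_intros) simp
    then have "(\<lambda>n. a + t n *\<^sub>R (x - a)) \<longlonglongrightarrow> x"
      by simp
    then show "g \<in> ?L"
      using infdist_differentiable_segment[OF a assms(3) t] unfolding d_eq g
      by (intro CollectI exI[of _ "\<lambda>n. a + t n *\<^sub>R (x - a)"] exI[of _ "\<lambda>n. sgn (x - a)"]) auto
  qed
  then show ?thesis
    unfolding clarke_grad_def by simp
qed

section \<open>Gradient bounds and directions of ascent\<close>

lemma compact_sgn_nearest:
  assumes "closed A" "x \<notin> A"
  shows "compact ((\<lambda>a. sgn (x - a)) ` nearest A x)"
proof (intro compact_continuous_image compact_nearest assms)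
  show "continuous_on (nearest A x) (\<lambda>a. sgn (x - a))"
    unfolding sgn_div_norm using assms(2)
    by (intro continuous_intros) (auto simp: nearest_def)
qed

lemma sgn_inner_ge_iff:
  fixes v :: "'a::real_inner"
  assumes "w \<noteq> 0"
  shows "c \<le> v \<bullet> sgn w \<longleftrightarrow> c * norm w \<le> v \<bullet> w" "c < v \<bullet> sgn w \<longleftrightarrow> c * norm w < v \<bullet> w"
  using assms by (simp_all add: sgn_div_norm field_simps)

text \<open>The generators of the convex hull lie in a half-space with unit normal \<open>v\<close>,
  so the hull does too; Cauchy-Schwarz turns this into a norm bound.\<close>

lemma Delta_ge_if_direction:
  assumes "closed A" "A \<noteq> {}" "x \<notin> A" and v: "norm v = 1"
    and ascent: "\<And>a. a \<in> nearest A x \<Longrightarrow> \<mu> * norm (x - a) \<le> v \<bullet> (x - a)"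
  shows "\<mu> \<le> Delta (clarke_grad (dist_fun A) x)"
proof -
  let ?H = "convex hull ((\<lambda>a. sgn (x - a)) ` nearest A x)"
  have "?H \<subseteq> {g. \<mu> \<le> v \<bullet> g}"
  proof (rule hull_minimal)
    show "(\<lambda>a. sgn (x - a)) ` nearest A x \<subseteq> {g. \<mu> \<le> v \<bullet> g}"
    proof clarsimp
      fix a
      assume a: "a \<in> nearest A x"
      then have "x - a \<noteq> 0"
        using assms(3) by (auto simp: nearest_def)
      then show "\<mu> \<le> v \<bullet> sgn (x - a)"
        using ascent[OF a] sgn_inner_ge_iff by blast
    qed
    show "convex {g. \<mu> \<le> v \<bullet> g}"
      using convex_halfspace_ge[of \<mu> v] by simp
  qed
  then have "\<mu> \<le> norm g" if "g \<in> ?H" for g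
    using that norm_cauchy_schwarz[of v g] v by auto
  moreover have "?H \<noteq> {}"
    using nearest_nonempty[OF assms(1,2)] by simp
  ultimately show ?thesis
    unfolding Delta_def clarke_grad_dist_fun[OF assms(1-3)] by (intro cINF_greatest) auto
qed

text \<open>A converse to the preceding bound: the direction is the normalised element of least norm
  in the hull, and the variational inequality for closest points gives the estimate.\<close>

lemma direction_if_zero_not_in:
  assumes "closed A" "A \<noteq> {}" "x \<notin> A" and 0: "0 \<notin> clarke_grad (dist_fun A) x"
    and Delta: "\<mu> \<le> Delta (clarke_grad (dist_fun A) x)"
  obtains v where "norm v = 1" "\<And>a. a \<in> nearest A x \<Longrightarrow> \<mu> * norm (x - a) \<le> v \<bullet> (x - a)"
proof -
  let ?H = "convex hull ((\<lambda>a. sgn (x - a)) ` nearest A x)"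
  have H: "clarke_grad (dist_fun A) x = ?H"
    using clarke_grad_dist_fun[OF assms(1-3)] .
  have "closed ?H"
    using compact_sgn_nearest[OF assms(1,3)] compact_convex_hull compact_imp_closed by blast
  have "?H \<noteq> {}"
    using nearest_nonempty[OF assms(1,2)] by simp
  define w where "w = closest_point ?H 0"
  have w: "w \<in> ?H" and min: "\<forall>g\<in>?H. dist 0 w \<le> dist 0 g"
    unfolding w_def using closest_point_exists[OF \<open>closed ?H\<close> \<open>?H \<noteq> {}\<close>] by blast+
  have "w \<noteq> 0"
    using w 0 H by auto
  have "\<mu> \<le> norm w"
  proof -
    have "bdd_below (norm ` ?H)"
      by (intro bdd_belowI[of _ 0]) auto
    then have "Inf (norm ` ?H) \<le> norm w"
      using w by (intro cInf_lower) auto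
    then show ?thesis
      using Delta by (simp add: Delta_def H)
  qed
  have "\<mu> * norm (x - a) \<le> sgn w \<bullet> (x - a)" if a: "a \<in> nearest A x" for a
  proof -
    have "x - a \<noteq> 0"
      using a assms(3) by (auto simp: nearest_def)
    have "sgn (x - a) \<in> ?H"
      using a by (intro hull_inc) auto
    then have "(0 - w) \<bullet> (sgn (x - a) - w) \<le> 0"
      using any_closest_point_dot[OF convex_convex_hull \<open>closed ?H\<close> w _ min] by blast
    then have "norm w * norm w \<le> w \<bullet> sgn (x - a)"
      by (simp add: inner_diff_right flip: power2_eq_square power2_norm_eq_inner)
    then have "norm w \<le> sgn w \<bullet> sgn (x - a)"
      using \<open>w \<noteq> 0\<close> by (simp add: sgn_div_norm[of w] field_simps)
    then have "\<mu> \<le> sgn w \<bullet> sgn (x - a)"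
      using \<open>\<mu> \<le> norm w\<close> by linarith
    then show ?thesis
      using sgn_inner_ge_iff(1)[OF \<open>x - a \<noteq> 0\<close>] by blast
  qed
  then show thesis
    using that[of "sgn w"] \<open>w \<noteq> 0\<close> by (simp add: norm_sgn)
qed

text \<open>The hull of a compact set is compact, so the infimum of the norms is attained.\<close>

lemma Delta_pos_iff_zero_not_in:
  assumes "closed A" "A \<noteq> {}" "x \<notin> A"
  shows "0 < Delta (clarke_grad (dist_fun A) x) \<longleftrightarrow> 0 \<notin> clarke_grad (dist_fun A) x"
proof -
  let ?H = "convex hull ((\<lambda>a. sgn (x - a)) ` nearest A x)"
  have H: "clarke_grad (dist_fun A) x = ?H"
    using clarke_grad_dist_fun[OF assms] .
  have "compact (norm ` ?H)"
    using compact_sgn_nearest[OF assms(1,3)] compact_convex_hull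
    by (intro compact_continuous_image continuous_intros) blast
  moreover have "norm ` ?H \<noteq> {}"
    using nearest_nonempty[OF assms(1,2)] by simp
  ultimately have "Inf (norm ` ?H) \<in> norm ` ?H"
    by (intro closed_contains_Inf compact_imp_closed) (auto intro: bdd_belowI[of _ 0])
  moreover have "Inf (norm ` ?H) \<le> 0" if "0 \<in> ?H"
    using that by (intro cInf_lower) (force intro: bdd_belowI[of _ 0])+
  ultimately show ?thesis
    unfolding H Delta_def by force
qed

text \<open>If growth at rate \<open>c\<close> failed for points tending to \<open>x0\<close> and
  steps tending to 0, nearest points of the moved points would accumulate at a nearest point of
  \<open>x0\<close>; convexity of the norm carries the failure to the limit, against the strict
  bound.\<close>

lemma local_ascent:
  fixes A :: "'a::euclidean_space set"
  assumes "closed A" "A \<noteq> {}" "x0 \<notin> A"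
    and ascent: "\<And>a. a \<in> nearest A x0 \<Longrightarrow> c * norm (x0 - a) < v \<bullet> (x0 - a)"
  obtains \<rho> where "\<rho> > 0"
    "\<And>x t. dist x0 x < \<rho> \<Longrightarrow> 0 \<le> t \<Longrightarrow> t < \<rho> \<Longrightarrow> infdist x A + c * t \<le> infdist (x + t *\<^sub>R v) A"
proof (rule ccontr)
  assume "\<not> thesis"
  then have "\<exists>x t. dist x0 x < inverse (real (Suc n)) \<and> 0 \<le> t \<and> t < inverse (real (Suc n)) \<and>
      infdist (x + t *\<^sub>R v) A < infdist x A + c * t" for n
    using that[of "inverse (real (Suc n))"] by (metis inverse_positive_iff_positive not_le of_nat_0_less_iff zero_less_Suc)
  then obtain x t where xt: "\<And>n. dist x0 (x n) < inverse (real (Suc n))" "\<And>n. 0 \<le> t n"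
      "\<And>n. t n < inverse (real (Suc n))"
      "\<And>n. infdist (x n + t n *\<^sub>R v) A < infdist (x n) A + c * t n"
    by metis
  have "(\<lambda>n. dist (x n) x0) \<longlonglongrightarrow> 0"
    using xt(1) by (intro LIMSEQ_0_if_less_inverse_Suc) (simp_all add: dist_commute)
  then have x: "x \<longlonglongrightarrow> x0"
    using tendsto_dist_iff by blast
  have "t \<longlonglongrightarrow> 0"
    using xt(2,3) by (rule LIMSEQ_0_if_less_inverse_Suc)
  then have "(\<lambda>n. x n + t n *\<^sub>R v) \<longlonglongrightarrow> x0 + 0 *\<^sub>R v"
    by (intro tendsto_intros x)
  then have y: "(\<lambda>n. x n + t n *\<^sub>R v) \<longlonglongrightarrow> x0"
    by simp
  obtain b where b: "\<And>n. b n \<in> nearest A (x n + t n *\<^sub>R v)"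
    using nearest_selection[OF assms(1,2), of "\<lambda>n. x n + t n *\<^sub>R v"] by blast
  obtain a r where a: "a \<in> nearest A x0" and r: "strict_mono (r :: nat \<Rightarrow> nat)" and lim: "(b \<circ> r) \<longlonglongrightarrow> a"
    using nearest_subseq[OF assms(1) y b] by metis
  have "v \<bullet> (x n - b n) \<le> c * norm (x n - b n)" for n
  proof -
    \<comment> \<open>\<open>u\<close> is a subgradient of the norm at \<open>x n - b n\<close>, so
      the step along \<open>v\<close> changes the norm by at least
      \<open>t n * (v \<bullet> u)\<close>. If the difference vanishes, \<open>u\<close> is 0 and
      the claim is trivial.\<close>
    define u where "u = sgn (x n - b n)"
    have nu: "norm u \<le> 1"
      by (simp add: u_def norm_sgn)
    have eq: "(x n - b n) \<bullet> u = norm (x n - b n)"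
      by (cases "x n = b n") (simp_all add: u_def sgn_div_norm power2_eq_square flip: power2_norm_eq_inner)
    have "infdist (x n) A \<le> norm (x n - b n)"
      using infdist_le[of "b n" A "x n"] b[of n] by (simp add: nearest_def dist_norm)
    moreover have "infdist (x n + t n *\<^sub>R v) A = norm (x n + t n *\<^sub>R v - b n)"
      using b[of n] by (simp add: nearest_def dist_norm)
    moreover have "(x n + t n *\<^sub>R v - b n) \<bullet> u \<le> norm (x n + t n *\<^sub>R v - b n)"
      using norm_cauchy_schwarz[of "x n + t n *\<^sub>R v - b n" u] nu
      by (smt (verit) mult_left_le norm_ge_zero)
    moreover have "(x n + t n *\<^sub>R v - b n) \<bullet> u = norm (x n - b n) + t n * (v \<bullet> u)"
      using eq by (simp add: algebra_simps)
    ultimately have "t n * (v \<bullet> u) < c * t n"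
      using xt(4)[of n] by linarith
    then have "v \<bullet> u < c"
      using xt(2)[of n] by (smt (verit) mult.commute mult_right_mono)
    then show ?thesis
      unfolding u_def using sgn_inner_ge_iff(1)[of "x n - b n" c v] by (cases "x n = b n") auto
  qed
  then have "\<And>n. v \<bullet> ((x \<circ> r) n - (b \<circ> r) n) \<le> c * norm ((x \<circ> r) n - (b \<circ> r) n)"
    by simp
  moreover have "(\<lambda>n. v \<bullet> ((x \<circ> r) n - (b \<circ> r) n)) \<longlonglongrightarrow> v \<bullet> (x0 - a)"
    "(\<lambda>n. c * norm ((x \<circ> r) n - (b \<circ> r) n)) \<longlonglongrightarrow> c * norm (x0 - a)"
    by (intro tendsto_intros lim LIMSEQ_subseq_LIMSEQ[OF x r])+
  ultimately have "v \<bullet> (x0 - a) \<le> c * norm (x0 - a)"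
    by (intro LIMSEQ_le) auto
  then show False
    using ascent[OF a] by simp
qed

subsection \<open>Offsets at regular values\<close>

lemma regular_value_ascent:
  fixes Y :: "'a::euclidean_space set"
  assumes "closed Y" "Y \<noteq> {}" "\<epsilon> > 0" "regular_value (dist_fun Y) \<epsilon>" "infdist x0 Y = \<epsilon>"
  obtains v c \<rho> where "norm v = 1" "c > 0" "\<rho> > 0"
    "\<And>x t. dist x0 x < \<rho> \<Longrightarrow> 0 \<le> t \<Longrightarrow> t < \<rho> \<Longrightarrow> infdist x Y + c * t \<le> infdist (x + t *\<^sub>R v) Y"
proof -
  have "x0 \<notin> Y"
    using assms(3,5) by auto
  have 0: "0 \<notin> clarke_grad (dist_fun Y) x0"
    using assms(4,5) by (simp add: regular_value_def dist_fun_def)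
  define D where "D = Delta (clarke_grad (dist_fun Y) x0)"
  have "D > 0"
    unfolding D_def using Delta_pos_iff_zero_not_in[OF assms(1,2) \<open>x0 \<notin> Y\<close>] 0 by blast
  obtain v where v: "norm v = 1" "\<And>a. a \<in> nearest Y x0 \<Longrightarrow> D * norm (x0 - a) \<le> v \<bullet> (x0 - a)"
    using direction_if_zero_not_in[OF assms(1,2) \<open>x0 \<notin> Y\<close> 0, of D] unfolding D_def by blast
  \<comment> \<open>Halving the rate yields the strict inequality that \<open>local_ascent\<close>
    asks for.\<close>
  have strict: "D / 2 * norm (x0 - a) < v \<bullet> (x0 - a)" if "a \<in> nearest Y x0" for a
  proof -
    have "norm (x0 - a) > 0"
      using that \<open>x0 \<notin> Y\<close> by (auto simp: nearest_def)
    then have "D / 2 * norm (x0 - a) < D * norm (x0 - a)"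
      using \<open>D > 0\<close> by simp
    then show ?thesis
      using v(2)[OF that] by linarith
  qed
  obtain \<rho> where "\<rho> > 0"
    "\<And>x t. dist x0 x < \<rho> \<Longrightarrow> 0 \<le> t \<Longrightarrow> t < \<rho> \<Longrightarrow> infdist x Y + D / 2 * t \<le> infdist (x + t *\<^sub>R v) Y"
    using local_ascent[OF assms(1,2) \<open>x0 \<notin> Y\<close> strict] by metis
  then show thesis
    using that[of v "D / 2" \<rho>] v(1) \<open>D > 0\<close> by simp
qed

text \<open>The lower bound is the Lipschitz property; the upper bound uses the point at distance
  \<epsilon> from \<open>Y\<close> on the segment from a nearest point to \<open>x\<close>.\<close>

lemma infdist_offset:
  fixes Y :: "'a::euclidean_space set"
  assumes "closed Y" "Y \<noteq> {}" "0 \<le> \<epsilon>" "\<epsilon> \<le> infdist x Y"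
  shows "infdist x {x. infdist x Y \<le> \<epsilon>} = infdist x Y - \<epsilon>"
proof (rule antisym)
  let ?X = "{x. infdist x Y \<le> \<epsilon>}"
  have "Y \<subseteq> ?X"
    using assms(3) by auto
  then have "?X \<noteq> {}"
    using assms(2) by blast
  have "closed ?X"
    by (intro closed_Collect_le continuous_intros)
  obtain b where b: "b \<in> ?X" "infdist x ?X = dist x b"
    using infdist_attains_inf[OF \<open>closed ?X\<close> \<open>?X \<noteq> {}\<close>] .
  then show "infdist x Y - \<epsilon> \<le> infdist x ?X"
    using infdist_triangle[of x Y b] by simp
  obtain a where a: "a \<in> nearest Y x"
    using nearest_nonempty[OF assms(1,2)] by blast
  have d: "norm (x - a) = infdist x Y"
    using a by (simp add: nearest_def dist_norm)
  show "infdist x ?X \<le> infdist x Y - \<epsilon>"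
  proof (cases "infdist x Y = 0")
    case True
    then show ?thesis
      using assms(3,4) by simp
  next
    case False
    then have pos: "infdist x Y > 0"
      using infdist_nonneg[of x Y] by linarith
    define p where "p = a + (\<epsilon> / infdist x Y) *\<^sub>R (x - a)"
    have "infdist p Y = \<epsilon>"
      unfolding p_def using nearest_dist_segment[OF a, of "\<epsilon> / infdist x Y"] assms(3,4) pos d by simp
    then have "infdist x ?X \<le> dist x p"
      by (intro infdist_le) simp
    also have "x - p = (1 - \<epsilon> / infdist x Y) *\<^sub>R (x - a)"
      by (simp add: p_def algebra_simps)
    then have "dist x p = (1 - \<epsilon> / infdist x Y) * infdist x Y"
      using assms(4) pos d by (simp add: dist_norm)
    also have "\<dots> = infdist x Y - \<epsilon>"
      using pos by (simp add: left_diff_distrib)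
    finally show ?thesis .
  qed
qed

text \<open>Growth of the distance forces growth of \<open>norm (x - a + t v)\<close> at rate
  \<open>c\<close>; squaring and comparing terms of first order in \<open>t\<close> gives the
  bound.\<close>

lemma direction_if_ascent:
  fixes A :: "'a::euclidean_space set"
  assumes a: "a \<in> nearest A x" and "norm v = 1" "\<rho> > 0" "c > 0"
    and ascent: "\<And>t. 0 \<le> t \<Longrightarrow> t < \<rho> \<Longrightarrow> infdist x A + c * t \<le> infdist (x + t *\<^sub>R v) A"
  shows "c * norm (x - a) \<le> v \<bullet> (x - a)"
proof (rule ccontr)
  assume less: "\<not> ?thesis"
  define \<delta> where "\<delta> = c * norm (x - a) - v \<bullet> (x - a)"
  have "\<delta> > 0"
    using less by (simp add: \<delta>_def)
  \<comment> \<open>The cap \<delta> keeps the quadratic term \<open>t * t\<close> below the linear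
    term \<open>2 * (t * \<delta>)\<close>.\<close>
  define t where "t = min (\<rho> / 2) \<delta>"
  have t: "0 < t" "t < \<rho>" "t \<le> \<delta>"
    using \<open>\<delta> > 0\<close> assms(3) by (auto simp: t_def)
  have "a \<in> A" "infdist x A = norm (x - a)"
    using a by (auto simp: nearest_def dist_norm)
  then have "norm (x - a) + c * t \<le> norm ((x - a) + t *\<^sub>R v)"
    using ascent[of t] t infdist_le[of a A "x + t *\<^sub>R v"] by (simp add: dist_norm algebra_simps)
  then have "(norm (x - a) + c * t)\<^sup>2 \<le> (norm ((x - a) + t *\<^sub>R v))\<^sup>2"
    using t assms(4) by (intro power_mono) auto
  also have "\<dots> = (norm (x - a))\<^sup>2 + 2 * t * (v \<bullet> (x - a)) + t\<^sup>2"
    using dot_norm[of "x - a" "t *\<^sub>R v"] assms(2) by (simp add: inner_commute power_mult_distrib)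
  finally have "2 * (t * \<delta>) + (c * t)\<^sup>2 \<le> t * t"
    unfolding \<delta>_def by (simp add: power2_eq_square algebra_simps)
  moreover have "(c * t)\<^sup>2 > 0"
    using t assms(4) by simp
  moreover have "t * t \<le> t * \<delta>"
    using t by (intro mult_left_mono) auto
  ultimately show False
    using mult_pos_pos[OF t(1) \<open>\<delta> > 0\<close>] by linarith
qed

section \<open>Gradient bound near the offset\<close>

lemma reach_mu_offset_pos:
  fixes Y :: "'a::euclidean_space set"
  assumes "compact Y" "Y \<noteq> {}" "\<epsilon> > 0" "regular_value (dist_fun Y) \<epsilon>"
  shows "\<exists>\<mu>. 0 < \<mu> \<and> \<mu> \<le> 1 \<and> reach_mu \<mu> {x. infdist x Y \<le> \<epsilon>} > 0"
proof -
  let ?X = "{x. infdist x Y \<le> \<epsilon>}"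
  let ?\<mu> = "\<lambda>n. inverse (real (Suc n))"
  have clY: "closed Y"
    using assms(1) compact_imp_closed by blast
  have clX: "closed ?X"
    by (intro closed_Collect_le continuous_intros)
  have "Y \<subseteq> ?X"
    using assms(3) by auto
  then have "?X \<noteq> {}"
    using assms(2) by blast
  have dX: "infdist x ?X = infdist x Y - \<epsilon>" if "\<epsilon> \<le> infdist x Y" for x
    using infdist_offset[OF clY assms(2) _ that] assms(3) by simp
  have outside: "\<epsilon> < infdist x Y" if "0 < infdist x ?X" for x
  proof (rule ccontr)
    assume "\<not> \<epsilon> < infdist x Y"
    then have "infdist x ?X = 0"
      by (intro infdist_zero) simp
    then show False
      using that by simp
  qed
  \<comment> \<open>One number \<open>?\<mu> n\<close> serves both as radius and as gradient bound,
    so failure yields a single sequence. It accumulates on the level set, where ascent holds at a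
    fixed rate \<open>c\<close>.\<close>
  have "\<exists>n. \<forall>x. 0 < infdist x ?X \<and> infdist x ?X \<le> ?\<mu> n \<longrightarrow> ?\<mu> n \<le> Delta (clarke_grad (dist_fun ?X) x)"
  proof (rule ccontr)
    assume "\<not> ?thesis"
    then have "\<exists>x. 0 < infdist x ?X \<and> infdist x ?X \<le> ?\<mu> n \<and> Delta (clarke_grad (dist_fun ?X) x) < ?\<mu> n" for n
      by (meson not_le)
    then obtain x where x: "\<And>n. 0 < infdist (x n) ?X" "\<And>n. infdist (x n) ?X \<le> ?\<mu> n"
        "\<And>n. Delta (clarke_grad (dist_fun ?X) (x n)) < ?\<mu> n"
      by metis
    have dY: "infdist (x n) Y = \<epsilon> + infdist (x n) ?X" for n
      using dX[of "x n"] outside[OF x(1)[of n]] by simp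
    have "?\<mu> n \<le> 1" for n
      by (simp add: field_simps)
    then have "\<And>n. infdist (x n) Y \<le> \<epsilon> + 1"
      using dY x(2) by (metis add_left_mono order_trans)
    then have "\<forall>n. x n \<in> {x. infdist x Y \<le> \<epsilon> + 1}"
      by simp
    moreover have "compact {x. infdist x Y \<le> \<epsilon> + 1}"
      using assms by (intro compact_infdist_le) auto
    ultimately obtain x0 r where r: "strict_mono (r :: nat \<Rightarrow> nat)" and lim: "(x \<circ> r) \<longlonglongrightarrow> x0"
      using compact_imp_seq_compact seq_compactE by metis
    have \<mu>lim: "(\<lambda>n. ?\<mu> (r n)) \<longlonglongrightarrow> 0"
      using LIMSEQ_subseq_LIMSEQ[OF LIMSEQ_inverse_real_of_nat r] by (simp add: o_def)
    have "(\<lambda>n. infdist (x (r n)) ?X) \<longlonglongrightarrow> 0"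
      by (rule tendsto_sandwich[OF _ _ tendsto_const \<mu>lim]) (intro always_eventually allI infdist_nonneg x(2))+
    then have "(\<lambda>n. \<epsilon> + infdist (x (r n)) ?X) \<longlonglongrightarrow> \<epsilon> + 0"
      by (intro tendsto_intros)
    moreover have "(\<lambda>n. infdist (x (r n)) Y) \<longlonglongrightarrow> infdist x0 Y"
      using tendsto_infdist[OF lim] by (simp add: o_def)
    ultimately have "infdist x0 Y = \<epsilon>"
      using dY LIMSEQ_unique by simp
    then obtain v c \<rho> where v: "norm v = 1" and "c > 0" "\<rho> > 0"
      and ascent: "\<And>x t. dist x0 x < \<rho> \<Longrightarrow> 0 \<le> t \<Longrightarrow> t < \<rho> \<Longrightarrow>
        infdist x Y + c * t \<le> infdist (x + t *\<^sub>R v) Y"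
      using regular_value_ascent[OF clY assms(2-4)] by metis
    obtain n where "?\<mu> (r n) < c" "dist ((x \<circ> r) n) x0 < \<rho>"
      using eventually_happens'[OF sequentially_bot
          eventually_conj[OF order_tendstoD(2)[OF \<mu>lim \<open>c > 0\<close>] tendstoD[OF lim \<open>\<rho> > 0\<close>]]]
      by blast
    then have n: "?\<mu> (r n) < c" "dist x0 (x (r n)) < \<rho>"
      by (simp_all add: dist_commute)
    define y where "y = x (r n)"
    have "y \<notin> ?X"
      using outside[OF x(1)[of "r n"]] by (simp add: y_def)
    \<comment> \<open>Ascent for the distance to \<open>Y\<close> keeps the moved point outside the
      offset, where the two distances differ by the constant \<epsilon>.\<close>
    have "infdist y ?X + c * t \<le> infdist (y + t *\<^sub>R v) ?X" if t: "0 \<le> t" "t < \<rho>" for t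
    proof -
      have "infdist y Y + c * t \<le> infdist (y + t *\<^sub>R v) Y"
        using ascent n(2) t by (simp add: y_def)
      moreover have "0 \<le> c * t"
        using t \<open>c > 0\<close> by simp
      ultimately show ?thesis
        using dX[of y] dX[of "y + t *\<^sub>R v"] \<open>y \<notin> ?X\<close> by simp
    qed
    then have "\<And>a. a \<in> nearest ?X y \<Longrightarrow> c * norm (y - a) \<le> v \<bullet> (y - a)"
      using direction_if_ascent[OF _ v \<open>\<rho> > 0\<close> \<open>c > 0\<close>] by blast
    then have "c \<le> Delta (clarke_grad (dist_fun ?X) y)"
      by (intro Delta_ge_if_direction[OF clX \<open>?X \<noteq> {}\<close> \<open>y \<notin> ?X\<close> v])
    then show False
      using x(3)[of "r n"] n(1) by (simp add: y_def)
  qed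
  then obtain n where n: "\<forall>x. 0 < infdist x ?X \<and> infdist x ?X \<le> ?\<mu> n \<longrightarrow>
      ?\<mu> n \<le> Delta (clarke_grad (dist_fun ?X) x)"
    by blast
  have "reach_mu (?\<mu> n) ?X \<ge> ereal (?\<mu> n)"
    unfolding reach_mu_def using n by (intro Sup_upper imageI) (simp add: dist_fun_def)
  moreover have "ereal (?\<mu> n) > 0"
    by simp
  moreover have "0 < ?\<mu> n" "?\<mu> n \<le> 1"
    by (simp_all add: field_simps)
  ultimately show ?thesis
    using less_le_trans by blast
qed

section \<open>The complement set of the offset and its reach\<close>

text \<open>At a critical value, a level point could be a local maximum of the distance to
  \<open>Y\<close> and not a limit of exterior points; the ascent direction rules this out.\<close>

lemma compl_set_offset:
  fixes Y :: "'a::euclidean_space set"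
  assumes "closed Y" "Y \<noteq> {}" "\<epsilon> > 0" "regular_value (dist_fun Y) \<epsilon>"
  shows "compl_set {x. infdist x Y \<le> \<epsilon>} = {x. \<epsilon> \<le> infdist x Y}"
proof
  have "closed {x. \<epsilon> \<le> infdist x Y}"
    by (intro closed_Collect_le continuous_intros)
  then show "compl_set {x. infdist x Y \<le> \<epsilon>} \<subseteq> {x. \<epsilon> \<le> infdist x Y}"
    unfolding compl_set_def by (intro closure_minimal) auto
  show "{x. \<epsilon> \<le> infdist x Y} \<subseteq> compl_set {x. infdist x Y \<le> \<epsilon>}"
  proof
    fix x
    assume x: "x \<in> {x. \<epsilon> \<le> infdist x Y}"
    show "x \<in> compl_set {x. infdist x Y \<le> \<epsilon>}"
    proof (cases "infdist x Y = \<epsilon>")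
      case False
      then show ?thesis
        using x unfolding compl_set_def by (intro closure_subset[THEN subsetD]) auto
    next
      case True
      then obtain v c \<rho> where v: "norm v = 1" and "c > 0" "\<rho> > 0"
        and ascent: "\<And>y t. dist x y < \<rho> \<Longrightarrow> 0 \<le> t \<Longrightarrow> t < \<rho> \<Longrightarrow>
          infdist y Y + c * t \<le> infdist (y + t *\<^sub>R v) Y"
        using regular_value_ascent[OF assms] by metis
      show ?thesis
        unfolding compl_set_def closure_approachable
      proof (intro allI impI)
        fix e :: real
        assume "e > 0"
        define t where "t = min e \<rho> / 2"
        have t: "0 < t" "t < e" "t < \<rho>"
          using \<open>e > 0\<close> \<open>\<rho> > 0\<close> by (auto simp: t_def)
        have "infdist x Y + c * t \<le> infdist (x + t *\<^sub>R v) Y"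
          using ascent[of x t] \<open>\<rho> > 0\<close> t by simp
        then have "\<epsilon> < infdist (x + t *\<^sub>R v) Y"
          using True t \<open>c > 0\<close> by (smt (verit) mult_pos_pos)
        moreover have "dist (x + t *\<^sub>R v) x < e"
          using t v by (simp add: dist_norm)
        ultimately show "\<exists>y\<in>UNIV - {x. infdist x Y \<le> \<epsilon>}. dist y x < e"
          by (intro bexI[of _ "x + t *\<^sub>R v"]) auto
      qed
    qed
  qed
qed

text \<open>The median formula of Apollonius, to be applied about \<open>x\<close> and about a
  nearest point of the midpoint in \<open>Y\<close>.\<close>

lemma norm_midpoint_diff_sq:
  fixes z1 z2 a :: "'a::euclidean_space"
  shows "(norm (midpoint z1 z2 - a))\<^sup>2 =
    ((norm (z1 - a))\<^sup>2 + (norm (z2 - a))\<^sup>2) / 2 - (norm (z1 - z2))\<^sup>2 / 4"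
  unfolding midpoint_def power2_norm_eq_inner
  by (simp add: inner_diff inner_add inner_commute field_simps)

text \<open>With \<open>Z\<close> the superlevel set and \<open>e\<close> the amount by which the
  midpoint \<open>m\<close> misses level \<epsilon>, the estimates chain as \<open>\<epsilon> * e
  \<le> L^2 / 4 \<le> 2 * r * infdist m Z \<le> 2 * r * e / c\<close>, which contradicts
  \<open>r < \<epsilon> * c / 2\<close>.\<close>

lemma unique_nearest_superlevel_local:
  fixes Y :: "'a::euclidean_space set"
  assumes "closed Y" "Y \<noteq> {}" "\<epsilon> > 0" "norm v = 1" "c > 0"
    and ascent: "\<And>x t. dist x0 x < \<rho> \<Longrightarrow> 0 \<le> t \<Longrightarrow> t < \<rho> \<Longrightarrow>
      infdist x Y + c * t \<le> infdist (x + t *\<^sub>R v) Y"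
    and x: "dist x0 x < \<rho> / 2"
    and r: "infdist x {x. \<epsilon> \<le> infdist x Y} < \<rho> / 2" "infdist x {x. \<epsilon> \<le> infdist x Y} < \<epsilon> * c / 2"
    and z: "z1 \<in> nearest {x. \<epsilon> \<le> infdist x Y} x" "z2 \<in> nearest {x. \<epsilon> \<le> infdist x Y} x"
  shows "z1 = z2"
proof (rule ccontr)
  let ?Z = "{x. \<epsilon> \<le> infdist x Y}"
  assume "z1 \<noteq> z2"
  define L where "L = norm (z1 - z2)"
  define r where "r = infdist x ?Z"
  define m where "m = midpoint z1 z2"
  have "L > 0"
    using \<open>z1 \<noteq> z2\<close> by (simp add: L_def)
  have z1: "\<epsilon> \<le> infdist z1 Y" "norm (z1 - x) = r" and z2: "\<epsilon> \<le> infdist z2 Y" "norm (z2 - x) = r"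
    using z by (auto simp: nearest_def r_def dist_norm norm_minus_commute)
  have "L \<le> 2 * r"
    using norm_triangle_ineq4[of "z1 - x" "z2 - x"] z1 z2 by (simp add: L_def)
  then have "r > 0"
    using \<open>L > 0\<close> by simp
  have mx: "(norm (m - x))\<^sup>2 = r\<^sup>2 - L\<^sup>2 / 4"
    using norm_midpoint_diff_sq[of z1 z2 x] z1 z2 by (simp add: m_def L_def)
  have "(norm (m - x))\<^sup>2 < r\<^sup>2"
    using mx \<open>L > 0\<close> by simp
  then have mx_less: "norm (m - x) < r"
    using \<open>r > 0\<close> by (simp add: power_less_imp_less_base)
  have "r \<le> infdist m ?Z + norm (m - x)"
    using infdist_triangle[of x ?Z m] by (simp add: r_def dist_norm norm_minus_commute)
  moreover have "L\<^sup>2 / 4 \<le> 2 * r * (r - norm (m - x))"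
  proof -
    have "L\<^sup>2 / 4 = (r + norm (m - x)) * (r - norm (m - x))"
      using mx by (simp add: power2_eq_square algebra_simps)
    also have "\<dots> \<le> (2 * r) * (r - norm (m - x))"
      using mx_less by (intro mult_right_mono) auto
    finally show ?thesis .
  qed
  ultimately have far: "L\<^sup>2 / 4 \<le> 2 * r * infdist m ?Z"
    using \<open>r > 0\<close> by (smt (verit) mult_left_mono)
  have "m \<notin> ?Z"
    using infdist_le[of m ?Z x] mx_less by (auto simp: r_def dist_norm norm_minus_commute)
  define e where "e = \<epsilon> - infdist m Y"
  have "e > 0"
    using \<open>m \<notin> ?Z\<close> by (simp add: e_def)
  obtain a where a: "a \<in> nearest Y m"
    using nearest_nonempty[OF assms(1,2)] by blast
  then have "a \<in> Y" "norm (m - a) = infdist m Y"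
    by (auto simp: nearest_def dist_norm)
  \<comment> \<open>Semiconcavity of the squared distance function, at the midpoint.\<close>
  have "\<epsilon>\<^sup>2 \<le> (norm (z1 - a))\<^sup>2" "\<epsilon>\<^sup>2 \<le> (norm (z2 - a))\<^sup>2"
    using z1 z2 infdist_le[OF \<open>a \<in> Y\<close>, of z1] infdist_le[OF \<open>a \<in> Y\<close>, of z2] assms(3)
    by (auto intro!: power_mono simp: dist_norm)
  then have "\<epsilon>\<^sup>2 - L\<^sup>2 / 4 \<le> (infdist m Y)\<^sup>2"
    using norm_midpoint_diff_sq[of z1 z2 a] \<open>norm (m - a) = infdist m Y\<close> by (simp add: m_def L_def)
  then have "(\<epsilon> + infdist m Y) * e \<le> L\<^sup>2 / 4"
    by (simp add: e_def power2_eq_square algebra_simps)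
  then have e_le: "\<epsilon> * e \<le> L\<^sup>2 / 4"
    using \<open>e > 0\<close> infdist_nonneg[of m Y] by (smt (verit) mult_right_mono)
  \<comment> \<open>This cruder bound ensures that the step \<open>e / c\<close>, which lifts
    \<open>m\<close> to level \<epsilon>, is shorter than \<rho>, so the ascent estimate
    applies.\<close>
  have "L\<^sup>2 / 4 \<le> r * r"
    using \<open>L \<le> 2 * r\<close> \<open>L > 0\<close> power_mono[of L "2 * r" 2] by (simp add: power2_eq_square)
  also have "\<dots> < (\<rho> / 2) * (\<epsilon> * c / 2)"
    using r \<open>r > 0\<close> unfolding r_def by (intro mult_strict_mono) auto
  finally have "\<epsilon> * e < \<epsilon> * (\<rho> * c / 4)"
    using e_le by (simp add: algebra_simps)
  then have "e < \<rho> * c / 4"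
    using assms(3) by simp
  moreover have "\<rho> > 0"
    using x zero_le_dist[of x0 x] by linarith
  ultimately have t: "0 \<le> e / c" "e / c < \<rho>"
    using \<open>e > 0\<close> assms(5) by (auto simp: field_simps)
  have "dist x0 m < \<rho>"
    using dist_triangle[of x0 m x] x mx_less r(1) by (simp add: r_def dist_norm norm_minus_commute)
  then have "infdist m Y + c * (e / c) \<le> infdist (m + (e / c) *\<^sub>R v) Y"
    using ascent t by blast
  then have "m + (e / c) *\<^sub>R v \<in> ?Z"
    using assms(5) by (simp add: e_def)
  then have "infdist m ?Z \<le> e / c"
    using infdist_le[of "m + (e / c) *\<^sub>R v" ?Z m] assms(4) t by (simp add: dist_norm)
  then have "2 * r * infdist m ?Z \<le> 2 * r * (e / c)"
    using \<open>r > 0\<close> by (intro mult_left_mono) auto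
  then have "\<epsilon> * e \<le> 2 * r * (e / c)"
    using far e_le by linarith
  then have "\<epsilon> * c \<le> 2 * r"
    using \<open>e > 0\<close> assms(5) by (simp add: field_simps)
  then show False
    using r(2) by (simp add: r_def)
qed

text \<open>Points with several nearest points, ever closer to the superlevel set, would accumulate
  on the level set, where the local result gives uniqueness.\<close>

lemma reach_superlevel_pos:
  fixes Y :: "'a::euclidean_space set"
  assumes "compact Y" "Y \<noteq> {}" "\<epsilon> > 0" "regular_value (dist_fun Y) \<epsilon>"
    and ne: "{x. \<epsilon> \<le> infdist x Y} \<noteq> {}"
  shows "reach {x. \<epsilon> \<le> infdist x Y} > 0"
proof -
  let ?Z = "{x. \<epsilon> \<le> infdist x Y}"
  let ?\<mu> = "\<lambda>n. inverse (real (Suc n))"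
  have clY: "closed Y"
    using assms(1) compact_imp_closed by blast
  have clZ: "closed ?Z"
    by (intro closed_Collect_le continuous_intros)
  have "\<exists>n. \<forall>x. infdist x ?Z < ?\<mu> n \<longrightarrow> (\<forall>z1\<in>nearest ?Z x. \<forall>z2\<in>nearest ?Z x. z1 = z2)"
  proof (rule ccontr)
    assume "\<not> ?thesis"
    then have "\<exists>x. infdist x ?Z < ?\<mu> n \<and> (\<exists>z1\<in>nearest ?Z x. \<exists>z2\<in>nearest ?Z x. z1 \<noteq> z2)" for n
      by blast
    then obtain x where x: "\<And>n. infdist (x n) ?Z < ?\<mu> n"
      "\<And>n. \<exists>z1\<in>nearest ?Z (x n). \<exists>z2\<in>nearest ?Z (x n). z1 \<noteq> z2"
      by metis
    \<comment> \<open>A point of \<open>?Z\<close> is its own only nearest point; hence the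
      counterexamples lie in a compact sublevel set.\<close>
    have "x n \<notin> ?Z" for n
    proof
      assume "x n \<in> ?Z"
      then have "nearest ?Z (x n) \<subseteq> {x n}"
        unfolding nearest_def using infdist_zero[OF \<open>x n \<in> ?Z\<close>] by auto
      then show False
        using x(2)[of n] by blast
    qed
    then have le: "infdist (x n) Y \<le> \<epsilon>" for n
      by (simp add: not_le less_imp_le)
    then have "\<forall>n. x n \<in> {x. infdist x Y \<le> \<epsilon>}"
      by simp
    moreover have "compact {x. infdist x Y \<le> \<epsilon>}"
      using assms by (intro compact_infdist_le) auto
    ultimately obtain x0 r where x0: "x0 \<in> {x. infdist x Y \<le> \<epsilon>}"
      and r: "strict_mono (r :: nat \<Rightarrow> nat)" and lim: "(x \<circ> r) \<longlonglongrightarrow> x0"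
      using compact_imp_seq_compact seq_compactE by metis
    have "(\<lambda>n. infdist (x n) ?Z) \<longlonglongrightarrow> 0"
      using x(1) by (intro LIMSEQ_0_if_less_inverse_Suc infdist_nonneg) auto
    then have Zlim: "(\<lambda>n. infdist (x (r n)) ?Z) \<longlonglongrightarrow> 0"
      using LIMSEQ_subseq_LIMSEQ[OF _ r] by (fastforce simp: o_def)
    then have "infdist x0 ?Z = 0"
      using tendsto_infdist[OF lim] LIMSEQ_unique by (force simp: o_def)
    then have "x0 \<in> ?Z"
      using in_closed_iff_infdist_zero[OF clZ ne] by blast
    then have "infdist x0 Y = \<epsilon>"
      using x0 by simp
    then obtain v c \<rho> where v: "norm v = 1" and "c > 0" "\<rho> > 0"
      and ascent: "\<And>x t. dist x0 x < \<rho> \<Longrightarrow> 0 \<le> t \<Longrightarrow> t < \<rho> \<Longrightarrow>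
        infdist x Y + c * t \<le> infdist (x + t *\<^sub>R v) Y"
      using regular_value_ascent[OF clY assms(2-4)] by metis
    have "eventually (\<lambda>n. infdist (x (r n)) ?Z < min (\<rho> / 2) (\<epsilon> * c / 2)) sequentially"
      using order_tendstoD(2)[OF Zlim, of "min (\<rho> / 2) (\<epsilon> * c / 2)"] \<open>c > 0\<close> \<open>\<rho> > 0\<close> assms(3)
      by simp
    moreover have "eventually (\<lambda>n. dist ((x \<circ> r) n) x0 < \<rho> / 2) sequentially"
      using tendstoD[OF lim, of "\<rho> / 2"] \<open>\<rho> > 0\<close> by simp
    ultimately have "eventually (\<lambda>n. infdist (x (r n)) ?Z < min (\<rho> / 2) (\<epsilon> * c / 2) \<and>
        dist ((x \<circ> r) n) x0 < \<rho> / 2) sequentially"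
      by (rule eventually_conj)
    then obtain n where n: "infdist (x (r n)) ?Z < min (\<rho> / 2) (\<epsilon> * c / 2)" "dist x0 (x (r n)) < \<rho> / 2"
      by (auto simp: eventually_sequentially dist_commute)
    have "z1 = z2" if "z1 \<in> nearest ?Z (x (r n))" "z2 \<in> nearest ?Z (x (r n))" for z1 z2
      using unique_nearest_superlevel_local[OF clY assms(2,3) v \<open>c > 0\<close> ascent n(2) _ _ that] n(1)
      by simp
    then show False
      using x(2)[of "r n"] by blast
  qed
  then obtain n where n: "\<And>x. infdist x ?Z < ?\<mu> n \<Longrightarrow>
      \<forall>z1\<in>nearest ?Z x. \<forall>z2\<in>nearest ?Z x. z1 = z2"
    by blast
  have "\<exists>!a. a \<in> ?Z \<and> dist x a = dist_fun ?Z x" if "dist_fun ?Z x < ?\<mu> n" for x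
  proof -
    have "\<exists>!a. a \<in> nearest ?Z x"
      using nearest_nonempty[OF clZ ne, of x] n[of x] that unfolding dist_fun_def by blast
    then show ?thesis
      by (simp add: nearest_def dist_fun_def)
  qed
  then have "reach ?Z \<ge> ereal (?\<mu> n)"
    unfolding reach_def by (intro Sup_upper imageI) simp
  moreover have "ereal (?\<mu> n) > 0"
    by simp
  ultimately show ?thesis
    using less_le_trans by blast
qed

text \<open>Moving from a point of the offset towards its nearest point in \<open>Y\<close> brings
  the distance strictly below \<epsilon>, which is an open condition.\<close>

lemma closure_interior_offset:
  fixes Y :: "'a::euclidean_space set"
  assumes "closed Y" "Y \<noteq> {}" "\<epsilon> > 0"
  shows "closure (interior {x. infdist x Y \<le> \<epsilon>}) = {x. infdist x Y \<le> \<epsilon>}"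
proof
  let ?X = "{x. infdist x Y \<le> \<epsilon>}"
  have "closed ?X"
    by (intro closed_Collect_le continuous_intros)
  then show "closure (interior ?X) \<subseteq> ?X"
    using closure_minimal interior_subset by blast
  have "open {x. infdist x Y < \<epsilon>}"
    by (intro open_Collect_less continuous_intros)
  then have int: "{x. infdist x Y < \<epsilon>} \<subseteq> interior ?X"
    by (intro interior_maximal) auto
  show "?X \<subseteq> closure (interior ?X)"
  proof
    fix x
    assume x: "x \<in> ?X"
    obtain a where a: "a \<in> nearest Y x"
      using nearest_nonempty[OF assms(1,2)] by blast
    have d: "norm (x - a) = infdist x Y"
      using a by (simp add: nearest_def dist_norm)
    define t where "t n = 1 - inverse (real (Suc n))" for n
    have t: "0 \<le> t n" "t n < 1" for n
      by (auto simp: t_def field_simps)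
    have "t \<longlonglongrightarrow> 1 - 0"
      unfolding t_def by (intro tendsto_diff LIMSEQ_inverse_real_of_nat) auto
    then have "(\<lambda>n. a + t n *\<^sub>R (x - a)) \<longlonglongrightarrow> a + 1 *\<^sub>R (x - a)"
      by (intro tendsto_intros) simp
    then have lim: "(\<lambda>n. a + t n *\<^sub>R (x - a)) \<longlonglongrightarrow> x"
      by simp
    have "a + t n *\<^sub>R (x - a) \<in> interior ?X" for n
    proof -
      have "infdist (a + t n *\<^sub>R (x - a)) Y = t n * infdist x Y"
        using nearest_dist_segment[OF a, of "t n"] t[of n] d by simp
      also have "\<dots> \<le> t n * \<epsilon>"
        using x t(1)[of n] by (intro mult_left_mono) auto
      also have "\<dots> < \<epsilon>"
        using t(2)[of n] assms(3) by simp
      finally show ?thesis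
        using int by blast
    qed
    then show "x \<in> closure (interior ?X)"
      unfolding closure_sequential using lim
      by (intro exI[of _ "\<lambda>n. a + t n *\<^sub>R (x - a)"]) simp
  qed
qed

lemma complementary_regular_offset:
  fixes Y :: "'a::euclidean_space set"
  assumes "compact Y" "Y \<noteq> {}" "\<epsilon> > 0" "regular_value (dist_fun Y) \<epsilon>"
  shows "complementary_regular {x. infdist x Y \<le> \<epsilon>}"
  unfolding complementary_regular_def
proof (intro conjI)
  let ?X = "{x. infdist x Y \<le> \<epsilon>}"
  have clY: "closed Y"
    using assms(1) compact_imp_closed by blast
  show "compact ?X"
    using assms by (intro compact_infdist_le) auto
  show "closure (interior ?X) = ?X"
    by (rule closure_interior_offset[OF clY assms(2,3)])
  show "\<exists>\<mu>. 0 < \<mu> \<and> \<mu> \<le> 1 \<and> 0 < reach_mu \<mu> ?X"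
    by (rule reach_mu_offset_pos[OF assms])
  \<comment> \<open>Boundedness of the offset makes the superlevel set nonempty; for an empty set
    \<open>infdist\<close> is 0 everywhere and nearest points do not exist.\<close>
  have "?X \<noteq> UNIV"
    using \<open>compact ?X\<close> not_bounded_UNIV compact_imp_bounded by metis
  then have "{x. \<epsilon> \<le> infdist x Y} \<noteq> {}"
    by (metis (mono_tags, lifting) UNIV_eq_I empty_iff linorder_linear mem_Collect_eq)
  then show "0 < reach (compl_set ?X)"
    unfolding compl_set_offset[OF clY assms(2-4)] by (rule reach_superlevel_pos[OF assms])
qed

subsection \<open>Inner parallel sets\<close>

text \<open>Along a sequence violating continuity, \<open>nearest_subseq\<close> yields a limit of
  projections that is nearest to the limit point, hence equal to its unique projection.\<close>

lemma continuous_on_nearest: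
  fixes A :: "'a::euclidean_space set"
  assumes "closed A" and \<pi>: "\<And>x. x \<in> S \<Longrightarrow> nearest A x = {\<pi> x}"
  shows "continuous_on S \<pi>"
  unfolding continuous_on_iff
proof (rule ccontr)
  assume "\<not> (\<forall>x\<in>S. \<forall>e>0. \<exists>d>0. \<forall>x'\<in>S. dist x' x < d \<longrightarrow> dist (\<pi> x') (\<pi> x) < e)"
  then obtain x e where x: "x \<in> S" "e > 0"
    and "\<And>d. d > 0 \<Longrightarrow> \<exists>x'\<in>S. dist x' x < d \<and> e \<le> dist (\<pi> x') (\<pi> x)"
    by (meson not_le)
  then have "\<exists>x'\<in>S. dist x' x < inverse (real (Suc n)) \<and> e \<le> dist (\<pi> x') (\<pi> x)" for n
    by simp
  then obtain s where s: "\<And>n. s n \<in> S" "\<And>n. dist (s n) x < inverse (real (Suc n))"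
      "\<And>n. e \<le> dist (\<pi> (s n)) (\<pi> x)"
    by metis
  have "(\<lambda>n. dist (s n) x) \<longlonglongrightarrow> 0"
    using s(2) by (intro LIMSEQ_0_if_less_inverse_Suc) auto
  then have lim: "s \<longlonglongrightarrow> x"
    using tendsto_dist_iff by blast
  have near: "\<pi> (s n) \<in> nearest A (s n)" for n
    using \<pi>[OF s(1)] by simp
  obtain a r where a: "a \<in> nearest A x" and r: "strict_mono (r :: nat \<Rightarrow> nat)"
    and lim': "((\<lambda>n. \<pi> (s n)) \<circ> r) \<longlonglongrightarrow> a"
    using nearest_subseq[OF assms(1) lim near] by metis
  have "a = \<pi> x"
    using a \<pi>[OF x(1)] by simp
  then have "eventually (\<lambda>n. dist (\<pi> (s (r n))) (\<pi> x) < e) sequentially"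
    using tendstoD[OF lim' x(2)] by simp
  then show False
    using s(3) by (auto simp: eventually_sequentially not_less[symmetric])
qed

text \<open>Brouwer's fixed point theorem replaces the usual integration of the gradient flow of the
  distance function: a fixed point \<open>y\<close> of the map \<open>\<Phi>\<close> satisfies \<open>y = x + \<tau> sgn (x - \<pi> y)\<close>, so that \<open>x\<close>
  lies on the segment from \<open>\<pi> y\<close> to \<open>y\<close>.\<close>
lemma normal_extension:
  fixes A :: "'a::euclidean_space set"
  assumes "closed A" "A \<noteq> {}" and uniq: "\<forall>y. infdist y A < R \<longrightarrow> (\<exists>!a. a \<in> nearest A y)"
    and "x \<notin> A" "infdist x A \<le> s" "s < R"
  obtains y where "infdist y A = s" "dist x y = s - infdist x A"
proof -
  define \<tau> where "\<tau> = s - infdist x A"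
  define \<pi> where "\<pi> y = (THE a. a \<in> nearest A y)" for y
  define \<Phi> where "\<Phi> y = x + \<tau> *\<^sub>R sgn (x - \<pi> y)" for y
  have "\<tau> \<ge> 0"
    using assms(5) by (simp add: \<tau>_def)
  \<comment> \<open>The ball of radius \<tau> stays within distance \<open>s < R\<close>, where
    nearest points are unique. The same bound is the upper half of
    \<open>infdist y A = s\<close>.\<close>
  have le_s: "infdist y A \<le> s" if "y \<in> cball x \<tau>" for y
    using that infdist_triangle[of y A x] by (simp add: \<tau>_def dist_commute)
  then have "\<exists>!a. a \<in> nearest A y" if "y \<in> cball x \<tau>" for y
    using uniq[rule_format, of y] le_s[OF that] assms(6) by simp
  then have \<pi>: "nearest A y = {\<pi> y}" if "y \<in> cball x \<tau>" for y
    unfolding \<pi>_def using that theI'[of "\<lambda>a. a \<in> nearest A y"] by blast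
  have ne: "\<pi> y \<noteq> x" if "y \<in> cball x \<tau>" for y
    using \<pi>[OF that] assms(4) by (auto simp: nearest_def)
  have "continuous_on (cball x \<tau>) \<pi>"
    by (rule continuous_on_nearest[OF assms(1) \<pi>])
  moreover have "\<forall>y\<in>cball x \<tau>. norm (x - \<pi> y) \<noteq> 0"
    using ne by (metis eq_iff_diff_eq_0 norm_eq_zero)
  ultimately have "continuous_on (cball x \<tau>) \<Phi>"
    unfolding \<Phi>_def sgn_div_norm by (intro continuous_intros)
  moreover have "\<Phi> \<in> cball x \<tau> \<rightarrow> cball x \<tau>"
    using \<open>\<tau> \<ge> 0\<close> by (auto simp: \<Phi>_def dist_norm norm_sgn)
  ultimately obtain y where y: "y \<in> cball x \<tau>" "\<Phi> y = y"
    using brouwer[of "cball x \<tau>" \<Phi>] \<open>\<tau> \<ge> 0\<close> by auto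
  define w where "w = x - \<pi> y"
  have "w \<noteq> 0" and near: "\<pi> y \<in> nearest A y"
    using ne[OF y(1)] \<pi>[OF y(1)] by (auto simp: w_def)
  have yw: "y = x + \<tau> *\<^sub>R sgn w"
    using y(2) by (simp add: \<Phi>_def w_def)
  have "dist x y = \<tau>"
    using yw \<open>w \<noteq> 0\<close> \<open>\<tau> \<ge> 0\<close> by (simp add: dist_norm norm_sgn)
  \<comment> \<open>Both summands point along \<open>w\<close>, so their lengths add; as
    \<open>norm w\<close> is at least the distance of \<open>x\<close>, this gives the lower
    half.\<close>
  have "y - \<pi> y = w + (y - x)"
    by (simp add: w_def)
  also have "y - x = (\<tau> / norm w) *\<^sub>R w"
    using yw by (simp add: sgn_div_norm divide_inverse mult.commute)
  also have "w + (\<tau> / norm w) *\<^sub>R w = (1 + \<tau> / norm w) *\<^sub>R w"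
    by (simp add: algebra_simps)
  finally have "norm (y - \<pi> y) = (1 + \<tau> / norm w) * norm w"
    using \<open>\<tau> \<ge> 0\<close> by (simp add: abs_of_nonneg)
  then have "norm (y - \<pi> y) = norm w + \<tau>"
    using \<open>w \<noteq> 0\<close> by (simp add: distrib_right)
  moreover have "infdist y A = norm (y - \<pi> y)" "infdist x A \<le> norm w"
    using near infdist_le[of "\<pi> y" A x] by (auto simp: nearest_def dist_norm w_def)
  ultimately have "infdist y A = s"
    using le_s[OF y(1)] by (simp add: \<tau>_def)
  then show thesis
    using that \<open>dist x y = \<tau>\<close> by (simp add: \<tau>_def)
qed

text \<open>Ekeland's variational argument: the perturbed distance function \<open>g\<close> cannot have its maximum where
  the distance is less than \<open>r\<close>, because there the distance grows at a rate larger than \<open>\<mu> / 2\<close>.\<close>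
lemma ascent_to_level:
  fixes A :: "'a::euclidean_space set"
  assumes "compact A" "A \<noteq> {}" "\<mu> > 0"
    and \<mu>: "\<And>x. 0 < infdist x A \<Longrightarrow> infdist x A \<le> r \<Longrightarrow> \<mu> \<le> Delta (clarke_grad (dist_fun A) x)"
    and p: "0 < infdist p A" "infdist p A \<le> r"
  obtains q where "infdist q A = r" "dist p q \<le> 2 * r / \<mu>"
proof -
  have clA: "closed A"
    using assms(1) compact_imp_closed by blast
  define g where "g q = infdist q A - \<mu> / 2 * dist p q" for q
  have "compact {q. infdist q A \<le> r}"
    using assms p by (intro compact_infdist_le) auto
  moreover have "continuous_on {q. infdist q A \<le> r} g"
    unfolding g_def by (intro continuous_intros)
  ultimately obtain q where q: "infdist q A \<le> r" and max: "\<And>y. infdist y A \<le> r \<Longrightarrow> g y \<le> g q"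
    using continuous_attains_sup[of "{q. infdist q A \<le> r}" g] p by auto
  \<comment> \<open>Comparing the maximiser with \<open>p\<close> gives both the positive distance
    at \<open>q\<close> and the final bound on \<open>dist p q\<close>.\<close>
  have pq: "infdist p A + \<mu> / 2 * dist p q \<le> infdist q A"
    using max[OF p(2)] by (simp add: g_def)
  have "infdist q A = r"
  proof (rule ccontr)
    assume "infdist q A \<noteq> r"
    then have less: "infdist q A < r"
      using q by simp
    have pos: "infdist q A > 0"
      using pq p(1) assms(3) by (smt (verit) mult_nonneg_nonneg zero_le_dist half_gt_zero)
    then have "q \<notin> A"
      by auto
    have "\<mu> \<le> Delta (clarke_grad (dist_fun A) q)"
      using \<mu>[OF pos q] .
    then have "0 \<notin> clarke_grad (dist_fun A) q"
      using Delta_pos_iff_zero_not_in[OF clA assms(2) \<open>q \<notin> A\<close>] assms(3) by linarith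
    then obtain v where v: "norm v = 1" "\<And>a. a \<in> nearest A q \<Longrightarrow> \<mu> * norm (q - a) \<le> v \<bullet> (q - a)"
      using direction_if_zero_not_in[OF clA assms(2) \<open>q \<notin> A\<close> _ \<open>\<mu> \<le> _\<close>] by blast
    \<comment> \<open>The rate 3/4 \<mu> lies strictly between the penalty slope \<mu>/2 and the
      available slope \<mu>: local ascent applies and a net gain remains.\<close>
    have strict: "3 / 4 * \<mu> * norm (q - a) < v \<bullet> (q - a)" if "a \<in> nearest A q" for a
    proof -
      have "norm (q - a) > 0"
        using that \<open>q \<notin> A\<close> by (auto simp: nearest_def)
      then have "\<mu> * norm (q - a) > 0"
        using assms(3) by simp
      then show ?thesis
        using v(2)[OF that] by linarith
    qed
    obtain \<rho> where "\<rho> > 0" and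
      ascent: "\<And>x t. dist q x < \<rho> \<Longrightarrow> 0 \<le> t \<Longrightarrow> t < \<rho> \<Longrightarrow>
        infdist x A + 3 / 4 * \<mu> * t \<le> infdist (x + t *\<^sub>R v) A"
      using local_ascent[OF clA assms(2) \<open>q \<notin> A\<close> strict] by metis
    \<comment> \<open>The cap \<open>r - infdist q A\<close> keeps the moved point in the set over
      which \<open>g\<close> is maximised.\<close>
    define t where "t = min (\<rho> / 2) (r - infdist q A)"
    have t: "0 < t" "t < \<rho>" "t \<le> r - infdist q A"
      using \<open>\<rho> > 0\<close> less by (auto simp: t_def)
    have dt: "dist q (q + t *\<^sub>R v) = t"
      using t v(1) by (simp add: dist_norm)
    have "infdist (q + t *\<^sub>R v) A \<le> r"
      using infdist_triangle[of "q + t *\<^sub>R v" A q] t dt by (simp add: dist_commute)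
    then have "g (q + t *\<^sub>R v) \<le> g q"
      by (rule max)
    moreover have "infdist q A + 3 / 4 * \<mu> * t \<le> infdist (q + t *\<^sub>R v) A"
      using ascent[of q t] \<open>\<rho> > 0\<close> t by simp
    moreover have "\<mu> / 2 * dist p (q + t *\<^sub>R v) \<le> \<mu> / 2 * (dist p q + t)"
      using dist_triangle[of p "q + t *\<^sub>R v" q] dt assms(3) by (intro mult_left_mono) auto
    ultimately have "\<mu> * t \<le> 0"
      by (simp add: g_def algebra_simps)
    then show False
      using t(1) assms(3) by (simp add: mult_le_0_iff)
  qed
  moreover have "dist p q \<le> 2 * r / \<mu>"
    using pq p(1) assms(3) \<open>infdist q A = r\<close> by (simp add: field_simps)
  ultimately show thesis
    using that by blast
qed

section \<open>The inner parallel set, its regular value, and the equivalence\<close>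

text \<open>Interior points not yet in \<open>Y\<close> reach it along a normal of the complement
  set; conversely, open \<epsilon>-balls about \<open>Y\<close> miss that set. The last claim places
  the level set on the boundary of \<open>X\<close>, where approximation from outside is
  possible.\<close>

lemma offset_of_inner_parallel:
  fixes X :: "'a::euclidean_space set"
  assumes "compact X" "X \<noteq> {}" and regular: "closure (interior X) = X"
    and uniq: "\<forall>y. infdist y (compl_set X) < R \<longrightarrow> (\<exists>!a. a \<in> nearest (compl_set X) y)"
    and \<epsilon>: "0 < \<epsilon>" "\<epsilon> < R"
  defines "Y \<equiv> {x. \<epsilon> \<le> infdist x (compl_set X)}"
  shows "compact Y" "Y \<noteq> {}" "X = {x. infdist x Y \<le> \<epsilon>}"
    "\<And>x. infdist x Y = \<epsilon> \<Longrightarrow> x \<in> compl_set X"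
proof -
  let ?Z = "compl_set X"
  have Z: "?Z = - interior X"
    by (simp add: compl_set_def closure_complement flip: Compl_eq_Diff_UNIV)
  have clX: "closed X"
    using assms(1) compact_imp_closed by blast
  have clZ: "closed ?Z"
    by (simp add: compl_set_def)
  have "X \<noteq> UNIV"
    using assms(1) not_bounded_UNIV compact_imp_bounded by metis
  then have "?Z \<noteq> {}"
    unfolding compl_set_def by auto
  \<comment> \<open>Off \<open>?Z\<close> this bound is strictly below \<epsilon>, which is what the
    last claim relies on; \<open>max\<close> covers points already in \<open>Y\<close>.\<close>
  have inY: "\<exists>y\<in>Y. dist x y \<le> max 0 (\<epsilon> - infdist x ?Z)" if x: "x \<notin> ?Z" for x
  proof (cases "\<epsilon> \<le> infdist x ?Z")
    case True
    then show ?thesis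
      by (intro bexI[of _ x]) (auto simp: Y_def)
  next
    case False
    then have "infdist x ?Z \<le> \<epsilon>"
      by simp
    then obtain y where "infdist y ?Z = \<epsilon>" "dist x y = \<epsilon> - infdist x ?Z"
      using normal_extension[OF clZ \<open>?Z \<noteq> {}\<close> uniq x _ \<epsilon>(2)] by metis
    then show ?thesis
      by (intro bexI[of _ y]) (auto simp: Y_def)
  qed
  have "interior X \<noteq> {}"
    using assms(2) regular by auto
  then show "Y \<noteq> {}"
    using inY Z by blast
  have "Y \<subseteq> X"
  proof
    fix y
    assume "y \<in> Y"
    then have "y \<notin> ?Z"
      using \<epsilon> by (auto simp: Y_def)
    then show "y \<in> X"
      using Z interior_subset by blast
  qed
  have clY: "closed Y"
    unfolding Y_def by (intro closed_Collect_le continuous_intros)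
  then show "compact Y"
    using \<open>Y \<subseteq> X\<close> assms(1) by (metis closed_Int_compact inf.absorb1)
  have near: "infdist x Y \<le> max 0 (\<epsilon> - infdist x ?Z)" if "x \<notin> ?Z" for x
    using inY[OF that] infdist_le order_trans by blast
  show "X = {x. infdist x Y \<le> \<epsilon>}"
  proof
    have "interior X \<subseteq> {x. infdist x Y \<le> \<epsilon>}"
    proof
      fix x
      assume "x \<in> interior X"
      then show "x \<in> {x. infdist x Y \<le> \<epsilon>}"
        using near[of x] Z \<epsilon>(1) infdist_nonneg[of x ?Z] by auto
    qed
    moreover have "closed {x. infdist x Y \<le> \<epsilon>}"
      by (intro closed_Collect_le continuous_intros)
    ultimately show "X \<subseteq> {x. infdist x Y \<le> \<epsilon>}"
      using regular closure_minimal by metis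
    show "{x. infdist x Y \<le> \<epsilon>} \<subseteq> X"
    proof
      fix x
      assume x: "x \<in> {x. infdist x Y \<le> \<epsilon>}"
      obtain y where y: "y \<in> Y" "infdist x Y = dist x y"
        using infdist_attains_inf[OF clY \<open>Y \<noteq> {}\<close>] .
      have "ball y \<epsilon> \<subseteq> X"
      proof
        fix z
        assume "z \<in> ball y \<epsilon>"
        then have "z \<notin> ?Z"
          using y(1) infdist_le[of z ?Z y] by (auto simp: Y_def)
        then show "z \<in> X"
          using Z interior_subset by blast
      qed
      then have "cball y \<epsilon> \<subseteq> X"
        using clX \<epsilon>(1) closure_minimal[of "ball y \<epsilon>" X] by simp
      then show "x \<in> X"
        using x y(2) by (auto simp: dist_commute)
    qed
  qed
  show "x \<in> ?Z" if "infdist x Y = \<epsilon>" for x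
  proof (rule ccontr)
    assume "x \<notin> ?Z"
    then have "infdist x ?Z > 0"
      using infdist_pos_not_in_closed[OF clZ \<open>?Z \<noteq> {}\<close>] by blast
    then show False
      using near[OF \<open>x \<notin> ?Z\<close>] that \<epsilon>(1) by auto
  qed
qed

text \<open>Otherwise all generators of the hull, and so the hull itself, would lie in an open
  half-space missing the origin.\<close>

lemma zero_in_clarke_grad_imp_obtuse:
  fixes Y :: "'a::euclidean_space set"
  assumes "closed Y" "Y \<noteq> {}" "x \<notin> Y" and 0: "0 \<in> clarke_grad (dist_fun Y) x"
  obtains a where "a \<in> nearest Y x" "w \<bullet> (x - a) \<le> 0"
proof (rule ccontr)
  assume "\<not> thesis"
  then have pos: "w \<bullet> (x - a) > 0" if "a \<in> nearest Y x" for a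
    using that \<open>\<And>a. a \<in> nearest Y x \<Longrightarrow> w \<bullet> (x - a) \<le> 0 \<Longrightarrow> thesis\<close> by force
  have "convex hull ((\<lambda>a. sgn (x - a)) ` nearest Y x) \<subseteq> {g. w \<bullet> g > 0}"
  proof (rule hull_minimal)
    show "convex {g. w \<bullet> g > 0}"
      by (rule convex_halfspace_gt)
    show "(\<lambda>a. sgn (x - a)) ` nearest Y x \<subseteq> {g. w \<bullet> g > 0}"
    proof clarsimp
      fix a
      assume a: "a \<in> nearest Y x"
      then have "x - a \<noteq> 0"
        using assms(3) by (auto simp: nearest_def)
      then show "0 < w \<bullet> sgn (x - a)"
        using pos[OF a] sgn_inner_ge_iff(2)[of "x - a" 0 w] by simp
    qed
  qed
  then show False
    using 0 clarke_grad_dist_fun[OF assms(1-3)] by auto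
qed

lemma regular_value_if_reach_mu_offset:
  fixes Y :: "'a::euclidean_space set"
  assumes "compact Y" "Y \<noteq> {}" "\<epsilon> > 0" "\<mu> > 0" "s > 0"
  defines "X \<equiv> {x. infdist x Y \<le> \<epsilon>}"
  assumes \<mu>: "\<And>x. 0 < infdist x X \<Longrightarrow> infdist x X \<le> s \<Longrightarrow> \<mu> \<le> Delta (clarke_grad (dist_fun X) x)"
    and boundary: "\<And>x. infdist x Y = \<epsilon> \<Longrightarrow> x \<in> compl_set X"
  shows "regular_value (dist_fun Y) \<epsilon>"
  unfolding regular_value_def
proof (intro allI impI notI)
  fix x
  assume "dist_fun Y x = \<epsilon>" and 0: "0 \<in> clarke_grad (dist_fun Y) x"
  then have x: "infdist x Y = \<epsilon>"
    by (simp add: dist_fun_def)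
  then have "x \<notin> Y" "x \<in> X"
    using assms(3) by (auto simp: X_def)
  have clY: "closed Y"
    using assms(1) compact_imp_closed by blast
  have "compact X"
    unfolding X_def using assms by (intro compact_infdist_le) auto
  have "closed X"
    using \<open>compact X\<close> compact_imp_closed by blast
  \<comment> \<open>The point \<open>q\<close> is reached from \<open>x\<close> via
    \<open>p\<close>, at a cost of \<open>r\<close> and then \<open>2 * r / \<mu>\<close>.\<close>
  define K where "K = 1 + 2 / \<mu>"
  have "K > 0"
    using assms(4) by (simp add: K_def add_pos_pos)
  \<comment> \<open>This makes the quadratic term \<open>(K * r)^2\<close> at most
    \<open>\<epsilon> * r\<close>, less than the linear gain
    \<open>2 * \<epsilon> * r\<close>.\<close>
  define r where "r = min s (\<epsilon> / K\<^sup>2)"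
  have r: "r > 0" "r \<le> s" "K\<^sup>2 * r \<le> \<epsilon>"
    using assms(3,5) \<open>K > 0\<close> by (auto simp: r_def field_simps min_def)
  obtain p where p: "p \<notin> X" "dist p x < r"
    using boundary[OF x] r(1) unfolding compl_set_def closure_approachable by blast
  have "0 < infdist p X"
    using infdist_pos_not_in_closed[OF \<open>closed X\<close> _ p(1)] \<open>x \<in> X\<close> by blast
  moreover have "infdist p X \<le> r"
    using infdist_le[OF \<open>x \<in> X\<close>, of p] p(2) by simp
  ultimately obtain q where q: "infdist q X = r" "dist p q \<le> 2 * r / \<mu>"
    using ascent_to_level[OF \<open>compact X\<close> _ assms(4), of r p] \<mu> r(2) \<open>x \<in> X\<close>
    by (metis empty_iff order_trans)
  have "norm (q - x) \<le> K * r"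
    using dist_triangle[of q x p] p(2) q(2)
    by (simp add: K_def dist_norm norm_minus_commute algebra_simps)
  \<comment> \<open>Criticality of \<open>x\<close> makes the cross term in the expansion of
    \<open>(norm (q - a))^2\<close> nonpositive.\<close>
  obtain a where a: "a \<in> nearest Y x" and obtuse: "(q - x) \<bullet> (x - a) \<le> 0"
    using zero_in_clarke_grad_imp_obtuse[OF clY assms(2) \<open>x \<notin> Y\<close> 0, of "q - x"] by metis
  have "a \<in> Y" "norm (x - a) = \<epsilon>"
    using a x by (auto simp: nearest_def dist_norm)
  have "q \<notin> X"
    using q(1) r(1) by auto
  then have "\<epsilon> \<le> infdist q Y"
    by (simp add: X_def)
  then have "r = infdist q Y - \<epsilon>"
    using infdist_offset[OF clY assms(2), of \<epsilon> q] q(1) assms(3) by (simp add: X_def)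
  then have "r + \<epsilon> \<le> norm (q - a)"
    using infdist_le[OF \<open>a \<in> Y\<close>, of q] by (simp add: dist_norm)
  then have "(r + \<epsilon>)\<^sup>2 \<le> (norm ((q - x) + (x - a)))\<^sup>2"
    using r(1) assms(3) by (intro power_mono) auto
  also have "\<dots> = (norm (q - x))\<^sup>2 + 2 * ((q - x) \<bullet> (x - a)) + (norm (x - a))\<^sup>2"
    using dot_norm[of "q - x" "x - a"] by simp
  also have "\<dots> \<le> (K * r)\<^sup>2 + \<epsilon>\<^sup>2"
    using power_mono[OF \<open>norm (q - x) \<le> K * r\<close>, of 2] obtuse \<open>norm (x - a) = \<epsilon>\<close> by simp
  finally have "r * (r + 2 * \<epsilon>) \<le> r * (K\<^sup>2 * r)"
    by (simp add: power2_eq_square algebra_simps)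
  then have "r + 2 * \<epsilon> \<le> K\<^sup>2 * r"
    using r(1) by simp
  then show False
    using r(1,3) assms(3) by linarith
qed

lemma offset_if_complementary_regular:
  fixes X :: "'a::euclidean_space set"
  assumes "complementary_regular X" "X \<noteq> {}"
  shows "\<exists>Y \<epsilon>. compact Y \<and> Y \<noteq> {} \<and> \<epsilon> > 0 \<and> regular_value (dist_fun Y) \<epsilon> \<and> X = {x. infdist x Y \<le> \<epsilon>}"
proof -
  have "compact X" and regular: "closure (interior X) = X" and "reach (compl_set X) > 0"
    using assms(1) by (auto simp: complementary_regular_def)
  obtain \<mu> where "\<mu> > 0" "reach_mu \<mu> X > 0"
    using assms(1) by (auto simp: complementary_regular_def)
  then obtain s where "s > 0"
    and s: "\<And>x. 0 < infdist x X \<Longrightarrow> infdist x X \<le> s \<Longrightarrow> \<mu> \<le> Delta (clarke_grad (dist_fun X) x)"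
    unfolding reach_mu_def less_Sup_iff by (auto simp: dist_fun_def)
  obtain R where "R > 0"
    and R: "\<forall>y. infdist y (compl_set X) < R \<longrightarrow> (\<exists>!a. a \<in> nearest (compl_set X) y)"
    using \<open>reach (compl_set X) > 0\<close> unfolding reach_def less_Sup_iff
    by (auto simp: dist_fun_def nearest_def)
  \<comment> \<open>Any value strictly between 0 and \<open>R\<close> would serve.\<close>
  define \<epsilon> where "\<epsilon> = R / 2"
  have \<epsilon>: "0 < \<epsilon>" "\<epsilon> < R"
    using \<open>R > 0\<close> by (auto simp: \<epsilon>_def)
  define Y where "Y = {x. \<epsilon> \<le> infdist x (compl_set X)}"
  note Y = offset_of_inner_parallel[OF \<open>compact X\<close> assms(2) regular R \<epsilon>, folded Y_def]
  have "regular_value (dist_fun Y) \<epsilon>"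
    using regular_value_if_reach_mu_offset[OF Y(1,2) \<epsilon>(1) \<open>\<mu> > 0\<close> \<open>s > 0\<close>, folded Y(3)] s Y(4)
    by blast
  then show ?thesis
    using Y(1-3) \<epsilon>(1) by blast
qed

text \<open>Since \<open>infdist x {}\<close> is 0, the gradient condition is vacuous; the
  complement set is the whole space, where each point is its own nearest point.\<close>

lemma complementary_regular_empty: "complementary_regular ({} :: 'a::euclidean_space set)"
proof -
  have "reach_mu 1 ({} :: 'a set) \<ge> ereal 1"
    unfolding reach_mu_def by (intro Sup_upper imageI) (simp add: dist_fun_def infdist_def)
  then have "reach_mu 1 ({} :: 'a set) > 0"
    using less_le_trans[of 0 "ereal 1"] by simp
  moreover have "reach (compl_set ({} :: 'a set)) \<ge> ereal 1"
    unfolding reach_def compl_set_def by (intro Sup_upper imageI) (simp add: dist_fun_def)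
  then have "reach (compl_set ({} :: 'a set)) > 0"
    using less_le_trans[of 0 "ereal 1"] by simp
  ultimately show ?thesis
    unfolding complementary_regular_def by (auto intro!: exI[of _ 1])
qed

theorem mainTheorem5:
  fixes X :: "'a::euclidean_space set"
  shows "complementary_regular X \<longleftrightarrow>
    (\<exists>Y \<epsilon>. compact Y \<and> \<epsilon> > 0 \<and> regular_value (dist_fun Y) \<epsilon> \<and> X = offset Y \<epsilon>)"
proof (cases "X = {}")
  case True
  \<comment> \<open>The distance to the empty set is constantly 0 and never takes the value
    1.\<close>
  have "regular_value (dist_fun ({} :: 'a set)) 1"
    by (simp add: regular_value_def dist_fun_def infdist_def)
  then have "\<exists>Y \<epsilon>. compact Y \<and> \<epsilon> > 0 \<and> regular_value (dist_fun Y) \<epsilon> \<and> X = offset Y \<epsilon>"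
    using True by (intro exI[of _ "{}"] exI[of _ 1]) (simp add: offset_def)
  then show ?thesis
    using True complementary_regular_empty by simp
next
  case False
  have "X = offset Y \<epsilon> \<longleftrightarrow> Y \<noteq> {} \<and> X = {x. infdist x Y \<le> \<epsilon>}" for Y \<epsilon>
    using False by (auto simp: offset_def dist_fun_def)
  then show ?thesis
    using offset_if_complementary_regular[OF _ False] complementary_regular_offset by metis
qed

end
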